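(* Let $K:\mathbf R_{\ge 0}\to\mathcal D'(\mathbf R)$ be the heat kernel, given for a test function $\phi\in\mathcal D(\mathbf R)$ by $\langle K(t),\phi\rangle=\int_{-\infty}^{\infty}\frac{e^{-s^2/4t}}{\sqrt{4\pi t}}\,\phi(s)\,ds$ if $t>0$, and $\langle K(0),\phi\rangle=\phi(0)$. Then $K$ is strongly smooth.
   Context: $\mathcal D(\mathbf R)$ is the space of smooth functions $\mathbf R\to\mathbf R$ of compact support, with its standard (Schwartz, inductive limit) locally convex topology. It carries the diffeology in which a map $p:U\to\mathcal D(\mathbf R)$ ($U$ open in some $\mathbf R^n$) is a smooth plot iff $T\circ p:U\to\mathbf R$ is smooth for every continuous linear functional $T$ on $\mathcal D(\mathbf R)$. $\mathcal D'(\mathbf R)$ is the vector space of distributions, i.e. continuous (equivalently, smooth) linear functionals $\mathcal D(\mathbf R)\to\mathbf R$. It carries the diffeology in which $p:U\to\mathcal D'(\mathbf R)$ is a smooth plot iff the transpose $U\times\mathcal D(\mathbf R)\to\mathbf R$ is smooth, i.e. takes smooth plots to smooth functions (a plot of a product being a pair of plots). With this structure $\mathcal D'(\mathbf R)$ is a convenient vector space. For a convenient vector space $X$ (a separated, bornological, Mackey-complete locally convex space), $X'$ denotes the set of continuous linear functionals $X\to\mathbf R$; these are the same as the linear functionals that are smooth, i.e. take smooth plots to smooth functions. A map $g:\mathbf R_{\ge 0}\to X$ is strongly smooth if for each natural number $n$ there exists a map $g^{(n)}:\mathbf R_{\ge 0}\to X$ such that for each $\phi\in X'$, $\phi\circ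 g$ is $n$ times differentiable (one-sidedly at $0$) with $(\phi\circ g)^{(n)}=\phi\circ g^{(n)}$. *)

theory Defs
  imports "HOL-Analysis.Analysis" "HOL-Probability.Distributions"
begin

section \<open>Test functions\<close>

definition smooth_real :: "(real \<Rightarrow> real) \<Rightarrow> bool" where
  "smooth_real f \<longleftrightarrow> (\<forall>k x. (deriv ^^ k) f differentiable (at x))"

definition supp :: "(real \<Rightarrow> real) \<Rightarrow> real set" where
  "supp f = closure {x. f x \<noteq> 0}"

lemma smooth_real_deriv:
  "smooth_real f \<Longrightarrow> ((deriv ^^ k) f has_real_derivative (deriv ^^ Suc k) f x) (at x)"
  by (simp add: smooth_real_def DERIV_deriv_iff_real_differentiable)

lemma deriv_funpow_lincomb:
  assumes "smooth_real f" "smooth_real g"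
  shows "(deriv ^^ k) (\<lambda>x. a * f x + b * g x) = (\<lambda>x. a * (deriv ^^ k) f x + b * (deriv ^^ k) g x)"
proof (induction k)
  case (Suc k)
  show ?case
  proof
    fix x
    have "((\<lambda>x. a * (deriv ^^ k) f x + b * (deriv ^^ k) g x) has_real_derivative
        a * (deriv ^^ Suc k) f x + b * (deriv ^^ Suc k) g x) (at x)"
      by (intro DERIV_add DERIV_cmult smooth_real_deriv assms)
    then show "(deriv ^^ Suc k) (\<lambda>x. a * f x + b * g x) x =
        a * (deriv ^^ Suc k) f x + b * (deriv ^^ Suc k) g x"
      using Suc.IH by (simp add: DERIV_imp_deriv)
  qed
qed simp

lemma smooth_real_lincomb:
  assumes "smooth_real f" "smooth_real g"
  shows "smooth_real (\<lambda>x. a * f x + b * g x)"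
  unfolding smooth_real_def
proof (intro allI)
  fix k x
  show "(deriv ^^ k) (\<lambda>x. a * f x + b * g x) differentiable at x"
    unfolding deriv_funpow_lincomb[OF assms] using assms
    by (auto simp: smooth_real_def intro!: derivative_intros)
qed

lemma deriv_funpow_zero: "(deriv ^^ k) (\<lambda>x::real. 0::real) = (\<lambda>x. 0)"
  by (induction k) auto

lemma smooth_real_zero: "smooth_real (\<lambda>x. 0)"
  by (simp add: smooth_real_def deriv_funpow_zero)

lemma compact_supp_lincomb:
  assumes "compact (supp f)" "compact (supp g)"
  shows "compact (supp (\<lambda>x. a * f x + b * g x))"
proof -
  have "supp (\<lambda>x. a * f x + b * g x) \<subseteq> supp f \<union> supp g"
    unfolding supp_def closure_Un[symmetric] by (rule closure_mono) auto
  then show ?thesis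
    using compact_Un[OF assms] by (metis closed_closure compact_Int_closed inf.absorb2 supp_def)
qed

typedef test_fun = "{f. smooth_real f \<and> compact (supp f)}"
  morphisms fun_of Abs_test_fun
  by (rule exI[of _ "\<lambda>x. 0"]) (simp add: smooth_real_zero supp_def)

setup_lifting type_definition_test_fun

instantiation test_fun :: real_vector
begin

lift_definition zero_test_fun :: test_fun is "\<lambda>x. 0"
  by (simp add: smooth_real_zero supp_def)

lift_definition plus_test_fun :: "test_fun \<Rightarrow> test_fun \<Rightarrow> test_fun" is "\<lambda>f g x. f x + g x"
  using smooth_real_lincomb[of _ _ 1 1] compact_supp_lincomb[of _ _ 1 1] by simp

lift_definition uminus_test_fun :: "test_fun \<Rightarrow> test_fun" is "\<lambda>f x. - f x"
  subgoal for f
    using smooth_real_lincomb[of f f "-1" 0] compact_supp_lincomb[of f f "-1" 0] by simp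
  done

lift_definition minus_test_fun :: "test_fun \<Rightarrow> test_fun \<Rightarrow> test_fun" is "\<lambda>f g x. f x - g x"
  using smooth_real_lincomb[of _ _ 1 "-1"] compact_supp_lincomb[of _ _ 1 "-1"] by simp

lift_definition scaleR_test_fun :: "real \<Rightarrow> test_fun \<Rightarrow> test_fun" is "\<lambda>c f x. c * f x"
  subgoal for c f
    using smooth_real_lincomb[of f f c 0] compact_supp_lincomb[of f f c 0] by simp
  done

instance
  by standard (transfer; simp add: fun_eq_iff algebra_simps)+

end

text \<open>The Schwartz topology is the finest locally convex topology for which the inclusions of the
  Frechet spaces of test functions supported in a compact set \<open>C\<close> are continuous. Its base of
  neighbourhoods of \<open>0\<close> consists of the absolutely convex sets whose trace on each of these Frechet
  spaces is a neighbourhood of \<open>0\<close> for the seminorms \<open>\<phi> \<mapsto> sup \<bar>\<phi>\<^sup>(\<^sup>k\<^sup>)\<bar>\<close>.\<close>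

definition test_nbhd0 :: "test_fun set \<Rightarrow> bool" where
  "test_nbhd0 V \<longleftrightarrow> convex V \<and> (\<forall>v\<in>V. \<forall>c. \<bar>c\<bar> \<le> 1 \<longrightarrow> c *\<^sub>R v \<in> V) \<and>
    (\<forall>C. compact C \<longrightarrow> (\<exists>N. \<exists>\<epsilon>>0. \<forall>\<phi>. supp (fun_of \<phi>) \<subseteq> C \<longrightarrow>
      (\<forall>k\<le>N. \<forall>x. \<bar>(deriv ^^ k) (fun_of \<phi>) x\<bar> < \<epsilon>) \<longrightarrow> \<phi> \<in> V))"

lemma test_nbhd0_UNIV: "test_nbhd0 UNIV"
  by (auto simp: test_nbhd0_def intro: exI[of _ 1])

lemma test_nbhd0_Int:
  assumes "test_nbhd0 V" "test_nbhd0 W"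
  shows "test_nbhd0 (V \<inter> W)"
proof -
  have "\<exists>N. \<exists>\<epsilon>>0. \<forall>\<phi>. supp (fun_of \<phi>) \<subseteq> C \<longrightarrow>
      (\<forall>k\<le>N. \<forall>x. \<bar>(deriv ^^ k) (fun_of \<phi>) x\<bar> < \<epsilon>) \<longrightarrow> \<phi> \<in> V \<inter> W" if C: "compact C" for C
  proof -
    obtain N e where 1: "e > 0" "\<And>\<phi>. supp (fun_of \<phi>) \<subseteq> C \<Longrightarrow>
      (\<forall>k\<le>N. \<forall>x. \<bar>(deriv ^^ k) (fun_of \<phi>) x\<bar> < e) \<Longrightarrow> \<phi> \<in> V"
      using assms(1) C unfolding test_nbhd0_def by meson
    obtain M d where 2: "d > 0" "\<And>\<phi>. supp (fun_of \<phi>) \<subseteq> C \<Longrightarrow>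
      (\<forall>k\<le>M. \<forall>x. \<bar>(deriv ^^ k) (fun_of \<phi>) x\<bar> < d) \<Longrightarrow> \<phi> \<in> W"
      using assms(2) C unfolding test_nbhd0_def by meson
    show ?thesis
      by (rule exI[of _ "max N M"], rule exI[of _ "min e d"]) (auto simp: 1 2)
  qed
  then show ?thesis
    using assms unfolding test_nbhd0_def by (auto intro: convex_Int)
qed

instantiation test_fun :: topological_space
begin

definition open_test_fun :: "test_fun set \<Rightarrow> bool" where
  "open_test_fun U \<longleftrightarrow> (\<forall>\<phi>\<in>U. \<exists>V. test_nbhd0 V \<and> (\<forall>\<psi>\<in>V. \<phi> + \<psi> \<in> U))"

instance
proof
  show "open (UNIV :: test_fun set)"
    using test_nbhd0_UNIV by (auto simp: open_test_fun_def)
next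
  fix S T :: "test_fun set"
  assume "open S" "open T"
  then show "open (S \<inter> T)"
    unfolding open_test_fun_def using test_nbhd0_Int by (metis Int_iff)
next
  fix K :: "test_fun set set"
  assume "\<forall>S\<in>K. open S"
  then show "open (\<Union>K)"
    unfolding open_test_fun_def by (meson Union_iff)
qed

end

section \<open>Distributions\<close>

typedef distribution = "{T :: test_fun \<Rightarrow> real. linear T \<and> continuous_on UNIV T}"
  morphisms dist_apply Abs_distribution
  by (rule exI[of _ "\<lambda>_. 0"]) (simp add: linear_iff)

setup_lifting type_definition_distribution

instantiation distribution :: real_vector
begin

lift_definition zero_distribution :: distribution is "\<lambda>\<phi>. 0"
  by (simp add: linear_iff)

lift_definition plus_distribution :: "distribution \<Rightarrow> distribution \<Rightarrow> distribution"
  is "\<lambda>S T \<phi>. S \<phi> + T \<phi>"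
  by (auto simp: linear_iff algebra_simps intro!: continuous_intros)

lift_definition uminus_distribution :: "distribution \<Rightarrow> distribution" is "\<lambda>T \<phi>. - T \<phi>"
  by (auto simp: linear_iff intro!: continuous_intros)

lift_definition minus_distribution :: "distribution \<Rightarrow> distribution \<Rightarrow> distribution"
  is "\<lambda>S T \<phi>. S \<phi> - T \<phi>"
  by (auto simp: linear_iff algebra_simps intro!: continuous_intros)

lift_definition scaleR_distribution :: "real \<Rightarrow> distribution \<Rightarrow> distribution" is "\<lambda>c T \<phi>. c * T \<phi>"
  by (auto simp: linear_iff algebra_simps intro!: continuous_intros)

instance
  by standard (transfer; simp add: fun_eq_iff algebra_simps)+

end

section \<open>Diffeologies\<close>

text \<open>Since the dimension of the domain of a plot varies, \<open>\<real>\<^sup>n\<close> is \<^const>\<open>Euclidean_space\<close> \<open>n\<close>, whose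
  points are the sequences vanishing from index \<open>n\<close> on. The predicate below says that \<open>f\<close> is of class
  \<open>C\<^sup>k\<close> on an open set \<open>U\<close> of it; values of \<open>f\<close> off \<open>U\<close> play no role.\<close>

fun Ck_on :: "nat \<Rightarrow> nat \<Rightarrow> (nat \<Rightarrow> real) set \<Rightarrow> ((nat \<Rightarrow> real) \<Rightarrow> real) \<Rightarrow> bool" where
  "Ck_on 0 n U f \<longleftrightarrow> continuous_on U f"
| "Ck_on (Suc k) n U f \<longleftrightarrow> continuous_on U f \<and>
     (\<forall>i<n. \<exists>g. Ck_on k n U g \<and>
       (\<forall>x\<in>U. ((\<lambda>t. f (x(i := t))) has_real_derivative g x) (at (x i))))"

definition smooth_on :: "nat \<Rightarrow> (nat \<Rightarrow> real) set \<Rightarrow> ((nat \<Rightarrow> real) \<Rightarrow> real) \<Rightarrow> bool" where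
  "smooth_on n U f \<longleftrightarrow> (\<forall>k. Ck_on k n U f)"

text \<open>A diffeology is given by its plots: \<open>P n U p\<close> means that \<open>p\<close>, restricted to the open set \<open>U\<close> of
  \<open>\<real>\<^sup>n\<close>, is a plot.\<close>

type_synonym 'a diffeology = "nat \<Rightarrow> (nat \<Rightarrow> real) set \<Rightarrow> ((nat \<Rightarrow> real) \<Rightarrow> 'a) \<Rightarrow> bool"

definition smooth_function :: "'a diffeology \<Rightarrow> ('a \<Rightarrow> real) \<Rightarrow> bool" where
  "smooth_function P f \<longleftrightarrow> (\<forall>n U p. P n U p \<longrightarrow> smooth_on n U (f \<circ> p))"

definition open_plot :: "nat \<Rightarrow> (nat \<Rightarrow> real) set \<Rightarrow> (nat \<Rightarrow> real) diffeology" where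
  "open_plot m V n U p \<longleftrightarrow> openin (Euclidean_space n) U \<and> p ` U \<subseteq> V \<and>
     (\<forall>i<m. smooth_on n U (\<lambda>x. p x i))"

definition prod_plot :: "'a diffeology \<Rightarrow> 'b diffeology \<Rightarrow> ('a \<times> 'b) diffeology" where
  "prod_plot P Q n U p \<longleftrightarrow> P n U (fst \<circ> p) \<and> Q n U (snd \<circ> p)"

definition test_plot :: "test_fun diffeology" where
  "test_plot n U p \<longleftrightarrow> openin (Euclidean_space n) U \<and>
     (\<forall>T :: distribution. smooth_on n U (dist_apply T \<circ> p))"

definition dist_plot :: "distribution diffeology" where
  "dist_plot n U p \<longleftrightarrow> openin (Euclidean_space n) U \<and>
     smooth_function (prod_plot (open_plot n U) test_plot) (\<lambda>(x, \<phi>). dist_apply (p x) \<phi>)"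

definition smooth_dual :: "'a::real_vector diffeology \<Rightarrow> ('a \<Rightarrow> real) set" where
  "smooth_dual P = {\<phi>. linear \<phi> \<and> smooth_function P \<phi>}"

section \<open>Strong smoothness\<close>

definition has_nth_derivative_on ::
    "nat \<Rightarrow> (real \<Rightarrow> real) \<Rightarrow> (real \<Rightarrow> real) \<Rightarrow> real set \<Rightarrow> bool" where
  "has_nth_derivative_on n f h S \<longleftrightarrow>
     (\<exists>D. (\<forall>t\<in>S. D 0 t = f t) \<and> (\<forall>t\<in>S. D n t = h t) \<and>
       (\<forall>k<n. \<forall>t\<in>S. (D k has_real_derivative D (Suc k) t) (at t within S)))"

text \<open>The first argument is the dual \<open>X'\<close> of the space \<open>X\<close>; only the values of \<open>g\<close> on \<open>{0..}\<close> matter.\<close>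

definition strongly_smooth :: "('a \<Rightarrow> real) set \<Rightarrow> (real \<Rightarrow> 'a) \<Rightarrow> bool" where
  "strongly_smooth X' g \<longleftrightarrow>
     (\<forall>n. \<exists>gn. \<forall>\<phi>\<in>X'. has_nth_derivative_on n (\<phi> \<circ> g) (\<phi> \<circ> gn) {0..})"

section \<open>The heat kernel\<close>

lemma continuous_on_fun_of: "continuous_on S (fun_of \<phi>)"
proof -
  have "smooth_real (fun_of \<phi>)" using fun_of[of \<phi>] by simp
  then have "fun_of \<phi> differentiable (at x)" for x
    unfolding smooth_real_def by (metis funpow_0)
  then show ?thesis
    by (meson continuous_at_imp_continuous_on differentiable_imp_continuous_within)
qed

lemma bounded_fun_of: "\<exists>B. \<forall>x. \<bar>fun_of \<phi> x\<bar> \<le> B"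
proof -
  have "compact (supp (fun_of \<phi>))" using fun_of[of \<phi>] by simp
  then have "bounded (fun_of \<phi> ` supp (fun_of \<phi>))"
    by (intro compact_imp_bounded compact_continuous_image continuous_on_fun_of)
  then obtain B where B: "\<And>x. x \<in> supp (fun_of \<phi>) \<Longrightarrow> \<bar>fun_of \<phi> x\<bar> \<le> B"
    by (auto simp: bounded_iff)
  have "x \<in> supp (fun_of \<phi>) \<or> fun_of \<phi> x = 0" for x
    using closure_subset[of "{x. fun_of \<phi> x \<noteq> 0}"] by (auto simp: supp_def)
  then have "\<bar>fun_of \<phi> x\<bar> \<le> max B 0" for x
    using B[of x] by (metis abs_zero max.cobounded1 max.cobounded2 order_trans)
  then show ?thesis by blast
qed

lemma continuous_on_test_fun_sup_bound:
  fixes T :: "test_fun \<Rightarrow> real"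
  assumes lin: "linear T"
    and bound: "\<And>\<phi> B. (\<And>x. \<bar>fun_of \<phi> x\<bar> \<le> B) \<Longrightarrow> \<bar>T \<phi>\<bar> \<le> B"
  shows "continuous_on UNIV T"
proof -
  have nb: "test_nbhd0 {\<psi>. \<bar>T \<psi>\<bar> < e}" if e: "e > 0" for e
    unfolding test_nbhd0_def
  proof (intro conjI ballI allI impI)
    have "{\<psi>. \<bar>T \<psi>\<bar> < e} = T -` ball 0 e" by (auto simp: dist_real_def)
    then show "convex {\<psi>. \<bar>T \<psi>\<bar> < e}"
      using convex_linear_vimage[OF lin convex_ball] by metis
  next
    fix v and c :: real
    assume v: "v \<in> {\<psi>. \<bar>T \<psi>\<bar> < e}" and c: "\<bar>c\<bar> \<le> 1"
    have "\<bar>c\<bar> * \<bar>T v\<bar> \<le> 1 * \<bar>T v\<bar>" by (intro mult_right_mono c) auto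
    then show "c *\<^sub>R v \<in> {\<psi>. \<bar>T \<psi>\<bar> < e}"
      using v by (simp add: linear_scale[OF lin] abs_mult)
  next
    fix C :: "real set"
    have "\<bar>T \<phi>\<bar> \<le> e / 2" if "\<forall>k\<le>0. \<forall>x. \<bar>(deriv ^^ k) (fun_of \<phi>) x\<bar> < e / 2" for \<phi>
      using that by (intro bound) (auto intro: less_imp_le)
    then show "\<exists>N. \<exists>\<epsilon>>0. \<forall>\<phi>. supp (fun_of \<phi>) \<subseteq> C \<longrightarrow>
      (\<forall>k\<le>N. \<forall>x. \<bar>(deriv ^^ k) (fun_of \<phi>) x\<bar> < \<epsilon>) \<longrightarrow> \<phi> \<in> {\<psi>. \<bar>T \<psi>\<bar> < e}"
      using e by (intro exI[of _ 0] exI[of _ "e/2"]) force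
  qed
  have "open (T -` S)" if S: "open S" for S
    unfolding open_test_fun_def
  proof
    fix \<phi> assume "\<phi> \<in> T -` S"
    then obtain e where e: "e > 0" "\<And>y. dist y (T \<phi>) < e \<Longrightarrow> y \<in> S"
      using S unfolding open_dist by auto
    then have "\<forall>\<psi>\<in>{\<psi>. \<bar>T \<psi>\<bar> < e}. \<phi> + \<psi> \<in> T -` S"
      by (auto simp: linear_add[OF lin] dist_real_def)
    then show "\<exists>V. test_nbhd0 V \<and> (\<forall>\<psi>\<in>V. \<phi> + \<psi> \<in> T -` S)"
      using nb[OF e(1)] by blast
  qed
  then show ?thesis by (simp add: continuous_on_open_vimage)
qed

lemma heat_density_eq:
  assumes "t > 0"
  shows "exp (- (s\<^sup>2 / (4 * t))) / sqrt (4 * pi * t) = normal_density 0 (sqrt (2 * t)) s"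
  using assms by (simp add: normal_density_def mult_ac)

lemma heat_integrable:
  assumes "t > 0"
  shows "integrable lborel (\<lambda>s. exp (- (s\<^sup>2 / (4 * t))) / sqrt (4 * pi * t) * fun_of \<phi> s)"
proof -
  obtain B where B: "\<And>x. \<bar>fun_of \<phi> x\<bar> \<le> B" using bounded_fun_of by blast
  have m: "fun_of \<phi> \<in> borel_measurable lborel"
    using borel_measurable_continuous_onI[OF continuous_on_fun_of] by simp
  have i: "integrable lborel (normal_density 0 (sqrt (2 * t)))"
    using assms by (intro integrable_normal_density) auto
  have "integrable lborel (\<lambda>s. normal_density 0 (sqrt (2 * t)) s * fun_of \<phi> s)"
  proof (rule Bochner_Integration.integrable_bound)
    show "integrable lborel (\<lambda>s. normal_density 0 (sqrt (2 * t)) s * B)" using i by simp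
    show "(\<lambda>s. normal_density 0 (sqrt (2 * t)) s * fun_of \<phi> s) \<in> borel_measurable lborel"
      using m by measurable
    show "AE s in lborel. norm (normal_density 0 (sqrt (2 * t)) s * fun_of \<phi> s)
        \<le> norm (normal_density 0 (sqrt (2 * t)) s * B)"
      using order_trans[OF B abs_ge_self] by (auto simp: abs_mult intro!: mult_left_mono)
  qed
  then show ?thesis using assms by (simp add: heat_density_eq)
qed

lemma heat_bound:
  assumes t: "t > 0" and B: "\<And>x. \<bar>fun_of \<phi> x\<bar> \<le> B"
  shows "\<bar>LINT s|lborel. exp (- (s\<^sup>2 / (4 * t))) / sqrt (4 * pi * t) * fun_of \<phi> s\<bar> \<le> B"
proof -
  have i: "integrable lborel (normal_density 0 (sqrt (2 * t)))"
    using t by (intro integrable_normal_density) auto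
  have "norm (LINT s|lborel. normal_density 0 (sqrt (2 * t)) s * fun_of \<phi> s)
      \<le> (LINT s|lborel. normal_density 0 (sqrt (2 * t)) s * B)"
  proof (rule Bochner_Integration.integral_norm_bound_integral)
    show "integrable lborel (\<lambda>s. normal_density 0 (sqrt (2 * t)) s * fun_of \<phi> s)"
      using heat_integrable[OF t, of \<phi>] t by (simp add: heat_density_eq)
    show "integrable lborel (\<lambda>s. normal_density 0 (sqrt (2 * t)) s * B)" using i by simp
  qed (use B in \<open>auto simp: abs_mult intro!: mult_left_mono\<close>)
  also have "\<dots> = B" using t by (simp add: integral_normal_density)
  finally show ?thesis using t by (simp add: heat_density_eq)
qed

text \<open>Only the values at \<open>t \<ge> 0\<close> are meaningful; the value at \<open>t < 0\<close> is arbitrary.\<close>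

lift_definition heat_kernel :: "real \<Rightarrow> distribution" is
  "\<lambda>t \<phi>. if t > 0
     then LINT s|lborel. exp (- (s\<^sup>2 / (4 * t))) / sqrt (4 * pi * t) * fun_of \<phi> s
     else fun_of \<phi> 0"
proof -
  fix t :: real
  let ?T = "\<lambda>\<phi>. if t > 0
     then LINT s|lborel. exp (- (s\<^sup>2 / (4 * t))) / sqrt (4 * pi * t) * fun_of \<phi> s
     else fun_of \<phi> 0"
  have lin: "linear ?T"
  proof (rule linearI)
    fix \<phi> \<psi>
    show "?T (\<phi> + \<psi>) = ?T \<phi> + ?T \<psi>"
      using heat_integrable[of t] by (simp add: plus_test_fun.rep_eq ring_distribs)
  next
    fix c \<phi>
    have "exp (- (s\<^sup>2 / (4 * t))) / sqrt (4 * pi * t) * (c * fun_of \<phi> s) =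
        c * (exp (- (s\<^sup>2 / (4 * t))) / sqrt (4 * pi * t) * fun_of \<phi> s)" for s
      by simp
    then show "?T (c *\<^sub>R \<phi>) = c *\<^sub>R ?T \<phi>"
      by (cases "t > 0") (simp_all only: scaleR_test_fun.rep_eq integral_mult_right_zero
        real_scaleR_def if_True if_False)
  qed
  have "continuous_on UNIV ?T"
  proof (rule continuous_on_test_fun_sup_bound[OF lin])
    fix \<phi> and B :: real
    assume "\<And>x. \<bar>fun_of \<phi> x\<bar> \<le> B"
    then show "\<bar>?T \<phi>\<bar> \<le> B"
      using heat_bound[of t \<phi> B] by (cases "t > 0") (simp_all only: if_True if_False)
  qed
  with lin show "linear ?T \<and> continuous_on UNIV ?T" ..
qed

end

theory Submission
  imports Defs
begin

text \<open>For a smooth linear functional \<open>\<Phi>\<close> on distributions and a bound on the order, \<open>\<Phi>\<close> is bounded on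
  the distributions of at most that order, in the operator norm: a violation could be spread along a
  smooth curve on which \<open>\<Phi>\<close> is unbounded near a point. That such a curve
  \<open>\<Sum>\<^sub>l sin (2\<^sup>l \<pi> s) / l! T\<^sub>l\<close> is a plot rests on the uniform boundedness principle: the family
  \<open>(T\<^sub>l \<phi>\<^sub>x)\<^sub>l\<close> is weak-* smooth in \<open>x\<close> with values in \<open>\<l>\<^sup>\<infinity>\<close> for every plot \<open>x \<mapsto> \<phi>\<^sub>x\<close> of test functions.
  By the semigroup property and Taylor's formula,
  \<open>\<bar>\<langle>K(t'), \<phi>\<rangle> - \<langle>K(t), \<phi>\<rangle> - (t' - t) \<langle>K(t), \<phi>''\<rangle>\<bar> \<le> 3/2 (t' - t)\<^sup>2 sup \<bar>\<phi>''''\<bar>\<close> for \<open>t, t' \<ge> 0\<close>, so the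
  difference quotients of \<open>t \<mapsto> K(t) \<circ> \<partial>\<^sup>2\<^sup>k\<close> converge to \<open>K(t) \<circ> \<partial>\<^sup>2\<^sup>k\<^sup>+\<^sup>2\<close> in such an operator norm, and \<open>\<Phi>\<close> preserves
  this convergence.\<close>

section \<open>Derivatives of test functions\<close>

text \<open>The complement of \<open>supp f\<close> is open and \<open>f\<close> is 0 on it, so at
  each of its points \<open>f\<close> has the derivative of a constant.\<close>

lemma supp_deriv: "supp (deriv f) \<subseteq> supp f"
  unfolding supp_def
proof (rule closure_minimal)
  show "{x. deriv f x \<noteq> 0} \<subseteq> closure {x. f x \<noteq> 0}"
  proof (rule subsetI, rule ccontr)
    fix x assume x: "x \<in> {x. deriv f x \<noteq> 0}" "x \<notin> closure {x. f x \<noteq> 0}"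
    define S where "S = - closure {x. f x \<noteq> 0}"
    have S: "open S" unfolding S_def by (rule open_Compl) (rule closed_closure)
    have xS: "x \<in> S" using x(2) by (simp add: S_def)
    have "0 = f y" if "y \<in> S" for y
      using that closure_subset[of "{x. f x \<noteq> 0}"] unfolding S_def by fastforce
    from has_field_derivative_transform_within_open[OF DERIV_const S xS this]
    have "(f has_real_derivative 0) (at x)" by simp
    then show False using x(1) DERIV_imp_deriv by auto
  qed
qed simp

lemma supp_deriv_funpow: "supp ((deriv ^^ k) f) \<subseteq> supp f"
proof (induction k)
  case (Suc k)
  then show ?case using supp_deriv[of "(deriv ^^ k) f"] by auto
qed simp

lift_definition test_deriv :: "nat \<Rightarrow> test_fun \<Rightarrow> test_fun" is "\<lambda>k. deriv ^^ k"
proof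
  fix k f assume f: "smooth_real f \<and> compact (supp f)"
  then show "smooth_real ((deriv ^^ k) f)"
    unfolding smooth_real_def by (metis funpow_add comp_apply)
  have "closed (supp ((deriv ^^ k) f))" by (simp add: supp_def)
  then show "compact (supp ((deriv ^^ k) f))"
    using f supp_deriv_funpow[of k f] by (metis compact_Int_closed inf.absorb2)
qed

lemma test_deriv_add: "test_deriv j (test_deriv k \<phi>) = test_deriv (j + k) \<phi>"
  by transfer (simp add: funpow_add)

lemma smooth_fun_of: "smooth_real (fun_of \<phi>)" using fun_of by blast

lemma linear_test_deriv: "linear (test_deriv k)"
proof (rule linearI)
  fix \<phi> \<psi> show "test_deriv k (\<phi> + \<psi>) = test_deriv k \<phi> + test_deriv k \<psi>"
    using deriv_funpow_lincomb[OF smooth_fun_of[of \<phi>] smooth_fun_of[of \<psi>], of k 1 1]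
    by (simp add: fun_of_inject[symmetric] test_deriv.rep_eq plus_test_fun.rep_eq)
next
  fix c \<phi> show "test_deriv k (c *\<^sub>R \<phi>) = c *\<^sub>R test_deriv k \<phi>"
    using deriv_funpow_lincomb[OF smooth_fun_of[of \<phi>] smooth_fun_of[of \<phi>], of k c 0]
    by (simp add: fun_of_inject[symmetric] test_deriv.rep_eq scaleR_test_fun.rep_eq)
qed

lemma bounded_derivatives: "\<exists>B. \<forall>k\<le>m. \<forall>x. \<bar>(deriv ^^ k) (fun_of \<phi>) x\<bar> \<le> B"
proof (induction m)
  case 0
  then show ?case using bounded_fun_of[of \<phi>] by simp
next
  case (Suc m)
  then obtain B where B: "\<And>k x. k \<le> m \<Longrightarrow> \<bar>(deriv ^^ k) (fun_of \<phi>) x\<bar> \<le> B" by blast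
  obtain C where C: "\<And>x. \<bar>(deriv ^^ Suc m) (fun_of \<phi>) x\<bar> \<le> C"
    using bounded_fun_of[of "test_deriv (Suc m) \<phi>"] by (auto simp: test_deriv.rep_eq)
  have "\<bar>(deriv ^^ k) (fun_of \<phi>) x\<bar> \<le> max B C" if "k \<le> Suc m" for k x
    using B[of k x] C[of x] that by (cases "k = Suc m") (simp_all add: le_max_iff_disj)
  then show ?case by blast
qed

section \<open>Functionals bounded by finitely many derivatives\<close>

text \<open>The constant \<open>C\<close> does not depend on the support, so one radius serves all
  compact sets at once in the definition of a neighbourhood of 0.\<close>

lemma continuous_on_test_fun_order_bound:
  fixes T :: "test_fun \<Rightarrow> real"
  assumes lin: "linear T"
    and bound: "\<And>\<phi> B. (\<And>k x. k \<le> m \<Longrightarrow> \<bar>(deriv ^^ k) (fun_of \<phi>) x\<bar> \<le> B) \<Longrightarrow> \<bar>T \<phi>\<bar> \<le> C * B"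
  shows "continuous_on UNIV T"
proof -
  have nb: "test_nbhd0 {\<psi>. \<bar>T \<psi>\<bar> < e}" if e: "e > 0" for e
    unfolding test_nbhd0_def
  proof (intro conjI ballI allI impI)
    have "{\<psi>. \<bar>T \<psi>\<bar> < e} = T -` ball 0 e" by (auto simp: dist_real_def)
    then show "convex {\<psi>. \<bar>T \<psi>\<bar> < e}"
      using convex_linear_vimage[OF lin convex_ball] by metis
  next
    fix v and c :: real
    assume v: "v \<in> {\<psi>. \<bar>T \<psi>\<bar> < e}" and c: "\<bar>c\<bar> \<le> 1"
    have "\<bar>c\<bar> * \<bar>T v\<bar> \<le> 1 * \<bar>T v\<bar>" by (intro mult_right_mono c) auto
    then show "c *\<^sub>R v \<in> {\<psi>. \<bar>T \<psi>\<bar> < e}"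
      using v by (simp add: linear_scale[OF lin] abs_mult)
  next
    fix K :: "real set"
    \<comment> \<open>\<open>C\<close> carries no sign condition; the summand 1 keeps the
      denominator positive and makes \<open>C * d < e\<close> strict.\<close>
    define d where "d = e / (\<bar>C\<bar> + 1)"
    have d: "d > 0" "C * d < e"
    proof -
      show d: "d > 0" unfolding d_def using e by simp
      have "C * d \<le> \<bar>C\<bar> * d" using d by (intro mult_right_mono) auto
      also have "\<dots> < (\<bar>C\<bar> + 1) * d" using d by simp
      also have "\<dots> = e" by (simp add: d_def)
      finally show "C * d < e" .
    qed
    have "\<phi> \<in> {\<psi>. \<bar>T \<psi>\<bar> < e}" if "\<forall>k\<le>m. \<forall>x. \<bar>(deriv ^^ k) (fun_of \<phi>) x\<bar> < d" for \<phi>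
      using bound[of \<phi> d] that d(2) by (simp add: less_imp_le) 
    then show "\<exists>N. \<exists>\<epsilon>>0. \<forall>\<phi>. supp (fun_of \<phi>) \<subseteq> K \<longrightarrow>
      (\<forall>k\<le>N. \<forall>x. \<bar>(deriv ^^ k) (fun_of \<phi>) x\<bar> < \<epsilon>) \<longrightarrow> \<phi> \<in> {\<psi>. \<bar>T \<psi>\<bar> < e}"
      using d(1) by blast
  qed
  have "open (T -` S)" if S: "open S" for S
    unfolding open_test_fun_def
  proof
    fix \<phi> assume "\<phi> \<in> T -` S"
    then obtain e where e: "e > 0" "\<And>y. dist y (T \<phi>) < e \<Longrightarrow> y \<in> S"
      using S unfolding open_dist by auto
    then have "\<forall>\<psi>\<in>{\<psi>. \<bar>T \<psi>\<bar> < e}. \<phi> + \<psi> \<in> T -` S"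
      by (auto simp: linear_add[OF lin] dist_real_def)
    then show "\<exists>V. test_nbhd0 V \<and> (\<forall>\<psi>\<in>V. \<phi> + \<psi> \<in> T -` S)"
      using nb[OF e(1)] by blast
  qed
  then show ?thesis by (simp add: continuous_on_open_vimage)
qed

text \<open>The operator norm of \<open>T\<close> dual to the norm given by the largest supremum of
  the derivatives up to order \<open>m\<close>, phrased through common bounds \<open>B\<close> so
  that no suprema have to be formed.\<close>

definition order_bound :: "nat \<Rightarrow> real \<Rightarrow> distribution \<Rightarrow> bool" where
  "order_bound m C T \<longleftrightarrow> (\<forall>\<phi> B. (\<forall>k\<le>m. \<forall>x. \<bar>(deriv ^^ k) (fun_of \<phi>) x\<bar> \<le> B) \<longrightarrow>
     \<bar>dist_apply T \<phi>\<bar> \<le> C * B)"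

lemma order_bound_scaleR:
  assumes "order_bound m C T"
  shows "order_bound m (\<bar>r\<bar> * C) (r *\<^sub>R T)"
  unfolding order_bound_def
proof (intro allI impI)
  fix \<phi> B assume "\<forall>k\<le>m. \<forall>x. \<bar>(deriv ^^ k) (fun_of \<phi>) x\<bar> \<le> B"
  then have "\<bar>dist_apply T \<phi>\<bar> \<le> C * B" using assms by (auto simp: order_bound_def)
  then show "\<bar>dist_apply (r *\<^sub>R T) \<phi>\<bar> \<le> \<bar>r\<bar> * C * B"
    by (simp add: scaleR_distribution.rep_eq abs_mult mult_left_mono mult.assoc)
qed

lemma linear_dist_apply: "linear (dist_apply T)"
  using dist_apply[of T] by simp

section \<open>Gaussian means\<close>

text \<open>The mean of \<open>F\<close> under the centred normal distribution of variance
  \<open>2 * t\<close>. \<open>F\<close> is not restricted to test functions, because the semigroup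
  property applies the mean to \<open>\<lambda>x. gauss_mean h (\<lambda>s. F (x + s))\<close>,
  which need not have compact support.\<close>

definition gauss_mean :: "real \<Rightarrow> (real \<Rightarrow> real) \<Rightarrow> real" where
  "gauss_mean t F = (if t > 0 then LINT s|lborel. normal_density 0 (sqrt (2 * t)) s * F s else F 0)"

lemma heat_kernel_eq_gauss_mean: "dist_apply (heat_kernel t) \<phi> = gauss_mean t (fun_of \<phi>)"
  by (simp add: heat_kernel.rep_eq gauss_mean_def heat_density_eq)

lemma integrable_normal_mult:
  assumes t: "\<sigma> > 0" and F [measurable]: "F \<in> borel_measurable borel" and B: "\<And>x. \<bar>F x\<bar> \<le> B"
  shows "integrable lborel (\<lambda>s. normal_density \<mu> \<sigma> s * F s)"
proof (rule Bochner_Integration.integrable_bound)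
  show "integrable lborel (\<lambda>s. normal_density \<mu> \<sigma> s * B)"
    using t by (intro integrable_mult_left integrable_normal_density)
  show "(\<lambda>s. normal_density \<mu> \<sigma> s * F s) \<in> borel_measurable lborel" by measurable
  show "AE s in lborel. norm (normal_density \<mu> \<sigma> s * F s) \<le> norm (normal_density \<mu> \<sigma> s * B)"
    using order_trans[OF B abs_ge_self] by (auto simp: abs_mult intro!: mult_left_mono)
qed

lemma gauss_mean_abs_le:
  assumes F: "F \<in> borel_measurable borel" and B: "\<And>x. \<bar>F x\<bar> \<le> B"
  shows "\<bar>gauss_mean t F\<bar> \<le> B"
proof (cases "t > 0")
  case t: True
  have "norm (LINT s|lborel. normal_density 0 (sqrt (2 * t)) s * F s)
      \<le> (LINT s|lborel. normal_density 0 (sqrt (2 * t)) s * B)"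
  proof (rule Bochner_Integration.integral_norm_bound_integral)
    show "integrable lborel (\<lambda>s. normal_density 0 (sqrt (2 * t)) s * F s)"
      using t by (intro integrable_normal_mult[OF _ F B]) simp
    show "integrable lborel (\<lambda>s. normal_density 0 (sqrt (2 * t)) s * B)"
      using t by (intro integrable_mult_left integrable_normal_density) simp
  qed (use B in \<open>auto simp: abs_mult intro!: mult_left_mono\<close>)
  then show ?thesis using t by (simp add: gauss_mean_def integral_normal_density)
qed (use B in \<open>simp add: gauss_mean_def\<close>)

lemma gauss_mean_lincomb:
  assumes F: "F \<in> borel_measurable borel" "\<And>x. \<bar>F x\<bar> \<le> B"
    and G: "G \<in> borel_measurable borel" "\<And>x. \<bar>G x\<bar> \<le> C"
  shows "gauss_mean t (\<lambda>x. F x + r * G x) = gauss_mean t F + r * gauss_mean t G"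
proof (cases "t > 0")
  case t: True
  have 1: "integrable lborel (\<lambda>s. normal_density 0 (sqrt (2 * t)) s * F s)"
    using t by (intro integrable_normal_mult[OF _ F]) simp
  have 2: "integrable lborel (\<lambda>s. normal_density 0 (sqrt (2 * t)) s * G s)"
    using t by (intro integrable_normal_mult[OF _ G]) simp
  show ?thesis using t 1 2
    by (simp add: gauss_mean_def distrib_left mult.left_commute[of _ r])
qed (simp add: gauss_mean_def)

lemma normal_convolution:
  assumes "0 < \<sigma>" "0 < \<tau>"
  shows "(LINT y|lborel. normal_density 0 \<sigma> (x - y) * normal_density 0 \<tau> y) =
    normal_density 0 (sqrt (\<sigma>\<^sup>2 + \<tau>\<^sup>2)) x"
  using fun_cong[OF conv_normal_density_zero_mean[OF assms], of x]
  by (subst integral_eq_nn_integral) auto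

lemma gauss_mean_shift:
  assumes h: "h > 0"
  shows "gauss_mean h (\<lambda>s. F (x + s)) = (LINT z|lborel. normal_density 0 (sqrt (2 * h)) (z - x) * F z)"
  using h lborel_integral_real_affine[of 1 "\<lambda>z. normal_density 0 (sqrt (2 * h)) (z - x) * F z" x]
  by (simp add: gauss_mean_def)

lemma gauss_mean_semigroup:
  assumes t: "t \<ge> 0" and h: "h > 0"
    and F [measurable]: "F \<in> borel_measurable borel" and B: "\<And>x. \<bar>F x\<bar> \<le> B"
  shows "gauss_mean (t + h) F = gauss_mean t (\<lambda>x. gauss_mean h (\<lambda>s. F (x + s)))"
proof (cases "t = 0")
  case False
  then have t: "t > 0" using t by simp
  let ?N = "\<lambda>t. normal_density 0 (sqrt (2 * t))"
  let ?f = "\<lambda>x z. ?N t x * (?N h (z - x) * F z)"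
  \<comment> \<open>Read as a function of \<open>z\<close>, the translated density is again a normal
    density, so it has integral 1.\<close>
  have shift: "?N h (z - x) = normal_density x (sqrt (2 * h)) z" for x z
    by (simp add: normal_density_def)
  \<comment> \<open>Replacing \<open>F\<close> by the constant \<open>B\<close> gives a majorant
    with elementary iterated integrals; \<open>?f\<close> is then integrable on the plane by
    comparison.\<close>
  have 1: "integrable (lborel \<Otimes>\<^sub>M lborel) (\<lambda>(x, z). ?N t x * (?N h (z - x) * B))"
  proof (rule lborel_pair.Fubini_integrable)
    show "(\<lambda>(x, z). ?N t x * (?N h (z - x) * B)) \<in> borel_measurable (lborel \<Otimes>\<^sub>M lborel)"
      unfolding normal_density_def by measurable
    have "integrable lborel (\<lambda>x. ?N t x * \<bar>B\<bar>)"
      using t by (intro integrable_mult_left integrable_normal_density) simp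
    then show "integrable lborel (\<lambda>x. LINT z|lborel. norm (case (x, z) of (x, z) \<Rightarrow> ?N t x * (?N h (z - x) * B)))"
      using h by (simp add: abs_mult shift integral_normal_density)
    show "AE x in lborel. integrable lborel (\<lambda>z. case (x, z) of (x, z) \<Rightarrow> ?N t x * (?N h (z - x) * B))"
      using h by (simp add: shift)
  qed
  have 2: "integrable (lborel \<Otimes>\<^sub>M lborel) (\<lambda>(x, z). ?f x z)"
  proof (rule Bochner_Integration.integrable_bound[OF 1])
    show "(\<lambda>(x, z). ?f x z) \<in> borel_measurable (lborel \<Otimes>\<^sub>M lborel)"
      unfolding normal_density_def by measurable
    have "\<bar>?f x z\<bar> \<le> \<bar>?N t x * (?N h (z - x) * B)\<bar>" for x z
      unfolding abs_mult by (intro mult_left_mono order_trans[OF B abs_ge_self]) auto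
    then show "AE p in lborel \<Otimes>\<^sub>M lborel. norm (case p of (x, z) \<Rightarrow> ?f x z)
        \<le> norm (case p of (x, z) \<Rightarrow> ?N t x * (?N h (z - x) * B))"
      by (intro AE_I2) (simp only: split_beta real_norm_def)
  qed
  have "gauss_mean t (\<lambda>x. gauss_mean h (\<lambda>s. F (x + s))) = (LINT x|lborel. LINT z|lborel. ?f x z)"
    using t by (simp add: gauss_mean_shift[OF h]) (simp add: gauss_mean_def)
  also have "\<dots> = (LINT z|lborel. LINT x|lborel. ?f x z)"
    by (rule lborel_pair.Fubini_integral[symmetric]) (use 2 in simp)
  also have "\<dots> = (LINT z|lborel. ?N (t + h) z * F z)"
  proof (rule Bochner_Integration.integral_cong[OF refl])
    fix z
    \<comment> \<open>For fixed \<open>z\<close> this is a convolution of two centred normal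
      densities, whose variances \<open>2 * h\<close> and \<open>2 * t\<close> add up.\<close>
    have "(LINT x|lborel. ?f x z) = (LINT x|lborel. ?N h (z - x) * ?N t x * F z)"
      by (simp add: mult_ac)
    also have "\<dots> = normal_density 0 (sqrt ((sqrt (2 * h))\<^sup>2 + (sqrt (2 * t))\<^sup>2)) z * F z"
      using t h by (simp only: integral_mult_left_zero) (subst normal_convolution, auto)
    also have "(sqrt (2 * h))\<^sup>2 + (sqrt (2 * t))\<^sup>2 = 2 * (t + h)" using t h by simp
    finally show "(LINT x|lborel. ?f x z) = ?N (t + h) z * F z" .
  qed
  also have "\<dots> = gauss_mean (t + h) F" using t h by (simp add: gauss_mean_def)
  finally show ?thesis ..
qed (simp add: gauss_mean_def)

text \<open>Taylor's formula for \<open>\<lambda>s. f (x + s)\<close> at 0 with Lagrange remainder;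
  the unknown intermediate point disappears in the uniform bound \<open>B\<close>.\<close>

lemma taylor_bound:
  assumes f: "smooth_real f" and B: "\<And>x. \<bar>(deriv ^^ n) f x\<bar> \<le> B"
  shows "\<bar>f (x + s) - (\<Sum>m<n. (deriv ^^ m) f x / fact m * s ^ m)\<bar> \<le> B / fact n * \<bar>s\<bar> ^ n"
proof -
  have "\<exists>t. \<bar>t\<bar> \<le> \<bar>s\<bar> \<and> f (x + s) = (\<Sum>m<n. (deriv ^^ m) f (x + 0) / fact m * s ^ m)
      + (deriv ^^ n) f (x + t) / fact n * s ^ n"
  proof (rule Maclaurin_bi_le[where f = "\<lambda>s. f (x + s)"])
    have "((\<lambda>s. (deriv ^^ m) f (x + s)) has_real_derivative (deriv ^^ Suc m) f (x + t)) (at t)" for m t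
      using DERIV_shift[of "(deriv ^^ m) f" "(deriv ^^ Suc m) f (x + t)" t x]
        smooth_real_deriv[OF f, of m "x + t"] by (simp add: add.commute)
    then show "\<forall>m t. m < n \<and> \<bar>t\<bar> \<le> \<bar>s\<bar> \<longrightarrow> ((\<lambda>s. (deriv ^^ m) f (x + s)) has_real_derivative
        (deriv ^^ Suc m) f (x + t)) (at t)" by blast
  qed simp
  then obtain t where "f (x + s) = (\<Sum>m<n. (deriv ^^ m) f (x + 0) / fact m * s ^ m)
      + (deriv ^^ n) f (x + t) / fact n * s ^ n" by blast
  then have "f (x + s) - (\<Sum>m<n. (deriv ^^ m) f x / fact m * s ^ m) =
      (deriv ^^ n) f (x + t) / fact n * s ^ n" by simp
  moreover have "\<bar>(deriv ^^ n) f (x + t)\<bar> / fact n * \<bar>s\<bar> ^ n \<le> B / fact n * \<bar>s\<bar> ^ n"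
    by (intro mult_right_mono divide_right_mono B) auto
  ultimately show ?thesis by (simp add: abs_mult power_abs)
qed

text \<open>The moments met when Taylor polynomials are averaged: the odd ones vanish, and for
  variance \<open>2 * h\<close> the fourth one is \<open>3 * (2 * h)\<^sup>2\<close>.\<close>

lemma normal_moments:
  assumes h: "h > 0"
  defines "N \<equiv> normal_density 0 (sqrt (2 * h))"
  shows "has_bochner_integral lborel (\<lambda>s. N s) 1"
    "has_bochner_integral lborel (\<lambda>s. N s * s) 0"
    "has_bochner_integral lborel (\<lambda>s. N s * s ^ 2) (2 * h)"
    "has_bochner_integral lborel (\<lambda>s. N s * s ^ 3) 0"
    "has_bochner_integral lborel (\<lambda>s. N s * s ^ 4) (12 * h\<^sup>2)"
proof -
  have s: "0 < sqrt (2 * h)" using h by simp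
  note e = normal_moment_even[OF s, of 0] and o = normal_moment_odd[OF s, of 0]
  show "has_bochner_integral lborel (\<lambda>s. N s) 1" using e[of 0] by (simp add: N_def)
  show "has_bochner_integral lborel (\<lambda>s. N s * s) 0" using o[of 0] by (simp add: N_def)
  show "has_bochner_integral lborel (\<lambda>s. N s * s ^ 2) (2 * h)"
    using e[of 1] h by (simp add: N_def)
  show "has_bochner_integral lborel (\<lambda>s. N s * s ^ 3) 0"
    using o[of 1] by (simp add: N_def numeral_3_eq_3)
  have "fact 4 / ((2 / (sqrt (2 * h))\<^sup>2) ^ 2 * fact 2) = 12 * h\<^sup>2"
    using h by (simp add: fact_numeral power_divide field_simps power2_eq_square)
  then show "has_bochner_integral lborel (\<lambda>s. N s * s ^ 4) (12 * h\<^sup>2)"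
    using e[of 2] by (simp add: N_def)
qed

text \<open>Averaging kills the odd Taylor terms, and the second moment turns the quadratic one into
  \<open>h\<close> times the second derivative. The remainders become \<open>B / 2 * (2 * h)\<close>
  and \<open>B / 24 * (12 * h\<^sup>2)\<close>. The bound \<open>B0\<close> gives
  integrability.\<close>

lemma gauss_mean_taylor:
  assumes h: "h > 0" and f: "smooth_real f" and f0: "\<And>x. \<bar>f x\<bar> \<le> B0"
  shows "(\<And>x. \<bar>(deriv ^^ 2) f x\<bar> \<le> B) \<Longrightarrow> \<bar>gauss_mean h (\<lambda>s. f (x + s)) - f x\<bar> \<le> B * h"
    and "(\<And>x. \<bar>(deriv ^^ 4) f x\<bar> \<le> B) \<Longrightarrow>
      \<bar>gauss_mean h (\<lambda>s. f (x + s)) - f x - h * (deriv ^^ 2) f x\<bar> \<le> B * h\<^sup>2 / 2"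
proof -
  let ?N = "normal_density 0 (sqrt (2 * h))"
  have "continuous_on UNIV f"
    using smooth_real_deriv[OF f, of 0] by (auto intro!: continuous_at_imp_continuous_on DERIV_isCont)
  then have "continuous_on UNIV (\<lambda>s. f (x + s))"
    by (rule continuous_on_compose2) (auto intro: continuous_on_add)
  then have mf: "(\<lambda>s. f (x + s)) \<in> borel_measurable borel"
    by (rule borel_measurable_continuous_onI)
  have i: "integrable lborel (\<lambda>s. ?N s * f (x + s))"
    using h by (intro integrable_normal_mult[OF _ mf f0]) simp
  note M = normal_moments[OF h]
  \<comment> \<open>Used with \<open>p\<close> the Taylor polynomial of degree 1 or 3 and
    \<open>r\<close> the bound of its remainder.\<close>
  have est: "\<bar>gauss_mean h (\<lambda>s. f (x + s)) - P\<bar> \<le> R"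
    if P: "has_bochner_integral lborel (\<lambda>s. ?N s * p s) P"
      and R: "has_bochner_integral lborel (\<lambda>s. ?N s * r s) R"
      and le: "\<And>s. \<bar>f (x + s) - p s\<bar> \<le> r s" for p r P R
  proof -
    have D: "has_bochner_integral lborel (\<lambda>s. ?N s * f (x + s) - ?N s * p s)
        (gauss_mean h (\<lambda>s. f (x + s)) - P)"
      using has_bochner_integral_diff[OF has_bochner_integral_integrable[OF i] P] h
      by (simp add: gauss_mean_def)
    have "norm (LINT s|lborel. ?N s * f (x + s) - ?N s * p s) \<le> (LINT s|lborel. ?N s * r s)"
    proof (rule Bochner_Integration.integral_norm_bound_integral)
      show "norm (?N s * f (x + s) - ?N s * p s) \<le> ?N s * r s" for s
        using mult_left_mono[OF le[of s], of "?N s"]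
        by (simp add: right_diff_distrib[symmetric] abs_mult)
    qed (use D R in \<open>auto simp: has_bochner_integral_iff\<close>)
    then show ?thesis using D R by (simp add: has_bochner_integral_iff)
  qed
  {
    assume B: "\<And>x. \<bar>(deriv ^^ 2) f x\<bar> \<le> B"
    have P: "has_bochner_integral lborel (\<lambda>s. ?N s * (f x + deriv f x * s)) (1 * f x + 0 * deriv f x)"
      using has_bochner_integral_add[OF has_bochner_integral_mult_left[OF M(1), of "f x"]
        has_bochner_integral_mult_left[OF M(2), of "deriv f x"]]
      by (simp only: distrib_left mult.assoc mult.commute[of "deriv f x"])
    have R: "has_bochner_integral lborel (\<lambda>s. ?N s * (B / 2 * s ^ 2)) (2 * h * (B / 2))"
      using has_bochner_integral_mult_left[OF M(3), of "B / 2"] by (simp add: mult_ac)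
    have "(\<Sum>m<2. (deriv ^^ m) f x / fact m * s ^ m) = f x + deriv f x * s" for s
      by (simp add: numeral_2_eq_2)
    then have "\<bar>f (x + s) - (f x + deriv f x * s)\<bar> \<le> B / 2 * s ^ 2" for s
      using taylor_bound[OF f B, of x s] by simp
    from est[OF P R this] show "\<bar>gauss_mean h (\<lambda>s. f (x + s)) - f x\<bar> \<le> B * h"
      by (simp add: mult.commute)
  next
    assume B: "\<And>x. \<bar>(deriv ^^ 4) f x\<bar> \<le> B"
    define d where "d = (\<lambda>k. (deriv ^^ k) f x)"
    have P: "has_bochner_integral lborel (\<lambda>s. ?N s * (d 0 + d 1 * s + d 2 / 2 * s ^ 2 + d 3 / 6 * s ^ 3))
        (1 * d 0 + 0 * d 1 + 2 * h * (d 2 / 2) + 0 * (d 3 / 6))"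
      using has_bochner_integral_add[OF has_bochner_integral_add[OF has_bochner_integral_add[OF
        has_bochner_integral_mult_left[OF M(1), of "d 0"]
        has_bochner_integral_mult_left[OF M(2), of "d 1"]]
        has_bochner_integral_mult_left[OF M(3), of "d 2 / 2"]]
        has_bochner_integral_mult_left[OF M(4), of "d 3 / 6"]]
      by (simp only: distrib_left mult.assoc mult.commute[of "d _"] mult.commute[of "d _ / _"])
    have R: "has_bochner_integral lborel (\<lambda>s. ?N s * (B / 24 * s ^ 4)) (12 * h\<^sup>2 * (B / 24))"
      using has_bochner_integral_mult_left[OF M(5), of "B / 24"] by (simp add: mult_ac)
    have "(\<Sum>m<4. (deriv ^^ m) f x / fact m * s ^ m) =
        d 0 + d 1 * s + d 2 / 2 * s ^ 2 + d 3 / 6 * s ^ 3" for s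
      unfolding d_def by (simp add: eval_nat_numeral)
    then have "\<bar>f (x + s) - (d 0 + d 1 * s + d 2 / 2 * s ^ 2 + d 3 / 6 * s ^ 3)\<bar> \<le> B / 24 * s ^ 4" for s
      using taylor_bound[OF f B, of x s] by (simp add: fact_numeral)
    from est[OF P R this]
    show "\<bar>gauss_mean h (\<lambda>s. f (x + s)) - f x - h * (deriv ^^ 2) f x\<bar> \<le> B * h\<^sup>2 / 2"
      by (simp add: d_def diff_diff_eq mult_ac)
  }
qed

section \<open>The heat equation\<close>

lemma fun_of_measurable: "fun_of \<phi> \<in> borel_measurable borel"
  by (intro borel_measurable_continuous_onI continuous_on_fun_of)

text \<open>By the semigroup property the increment is the mean at time \<open>t\<close> of
  \<open>\<lambda>x. ?P x - ?f x\<close>, which Taylor's formula controls uniformly in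
  \<open>x\<close>. Averaging does not enlarge these bounds, so they hold alike for all
  \<open>t\<close>, including \<open>t = 0\<close>.\<close>

lemma heat_kernel_increment:
  assumes t: "t \<ge> 0" and h: "h > 0"
  shows "(\<And>x. \<bar>fun_of (test_deriv 2 \<phi>) x\<bar> \<le> B) \<Longrightarrow>
      \<bar>dist_apply (heat_kernel (t + h)) \<phi> - dist_apply (heat_kernel t) \<phi>\<bar> \<le> B * h"
    and "(\<And>x. \<bar>fun_of (test_deriv 4 \<phi>) x\<bar> \<le> B) \<Longrightarrow>
      \<bar>dist_apply (heat_kernel (t + h)) \<phi> - dist_apply (heat_kernel t) \<phi>
        - h * dist_apply (heat_kernel t) (test_deriv 2 \<phi>)\<bar> \<le> B * h\<^sup>2 / 2"
proof -
  let ?f = "fun_of \<phi>" and ?f2 = "fun_of (test_deriv 2 \<phi>)"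
  let ?P = "\<lambda>x. gauss_mean h (\<lambda>s. ?f (x + s))"
  note [measurable] = fun_of_measurable
  obtain B0 where B0: "\<And>x. \<bar>?f x\<bar> \<le> B0" using bounded_fun_of by blast
  obtain B2 where B2: "\<And>x. \<bar>?f2 x\<bar> \<le> B2" using bounded_fun_of by blast
  have PB: "\<bar>?P x\<bar> \<le> B0" for x
    by (rule gauss_mean_abs_le[OF _ B0]) measurable
  have [measurable]: "?P \<in> borel_measurable borel"
    using h by (simp add: gauss_mean_def normal_density_def) measurable
  have eq: "dist_apply (heat_kernel (t + h)) \<phi> = gauss_mean t ?P"
    unfolding heat_kernel_eq_gauss_mean by (rule gauss_mean_semigroup[OF t h _ B0]) measurable
  have D: "gauss_mean t (\<lambda>x. ?P x - ?f x) = dist_apply (heat_kernel (t + h)) \<phi> - dist_apply (heat_kernel t) \<phi>"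
    using gauss_mean_lincomb[of ?P B0 ?f B0 t "-1"] PB B0 eq by (simp add: heat_kernel_eq_gauss_mean)
  have DB: "\<bar>?P x - ?f x\<bar> \<le> 2 * B0" for x using PB[of x] B0[of x] by linarith
  {
    assume B: "\<And>x. \<bar>?f2 x\<bar> \<le> B"
    have "\<bar>?P x - ?f x\<bar> \<le> B * h" for x
      using gauss_mean_taylor(1)[OF h smooth_fun_of B0, of B x] B by (simp add: test_deriv.rep_eq)
    then have "\<bar>gauss_mean t (\<lambda>x. ?P x - ?f x)\<bar> \<le> B * h"
      by (intro gauss_mean_abs_le) auto
    then show "\<bar>dist_apply (heat_kernel (t + h)) \<phi> - dist_apply (heat_kernel t) \<phi>\<bar> \<le> B * h"
      unfolding D .
  next
    assume B: "\<And>x. \<bar>fun_of (test_deriv 4 \<phi>) x\<bar> \<le> B"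
    have "\<bar>?P x - ?f x + - h * ?f2 x\<bar> \<le> B * h\<^sup>2 / 2" for x
      using gauss_mean_taylor(2)[OF h smooth_fun_of B0, of B x] B by (simp add: test_deriv.rep_eq)
    then have "\<bar>gauss_mean t (\<lambda>x. ?P x - ?f x + - h * ?f2 x)\<bar> \<le> B * h\<^sup>2 / 2"
      by (intro gauss_mean_abs_le) auto
    also have "gauss_mean t (\<lambda>x. ?P x - ?f x + - h * ?f2 x) =
        gauss_mean t (\<lambda>x. ?P x - ?f x) + - h * gauss_mean t ?f2"
      by (rule gauss_mean_lincomb[OF _ DB _ B2]) measurable
    finally show "\<bar>dist_apply (heat_kernel (t + h)) \<phi> - dist_apply (heat_kernel t) \<phi>
        - h * dist_apply (heat_kernel t) (test_deriv 2 \<phi>)\<bar> \<le> B * h\<^sup>2 / 2"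
      unfolding D by (simp add: heat_kernel_eq_gauss_mean)
  }
qed

text \<open>The increment estimates go forward in time. For \<open>s > t\<close> they give the
  constant 1/2. For \<open>s < t\<close> the expansion is around \<open>s\<close>, and replacing
  \<open>?G s\<close> by \<open>?G t\<close> costs a further \<open>B * (t - s)\<^sup>2\<close>,
  whence 3/2.\<close>

lemma heat_kernel_quotient:
  assumes st: "s \<ge> 0" "t \<ge> 0" "s \<noteq> t" and B: "\<And>x. \<bar>fun_of (test_deriv 4 \<phi>) x\<bar> \<le> B"
  shows "\<bar>(dist_apply (heat_kernel s) \<phi> - dist_apply (heat_kernel t) \<phi>) / (s - t)
    - dist_apply (heat_kernel t) (test_deriv 2 \<phi>)\<bar> \<le> 3 / 2 * \<bar>s - t\<bar> * B"
proof -
  let ?H = "\<lambda>t. dist_apply (heat_kernel t) \<phi>"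
  let ?G = "\<lambda>t. dist_apply (heat_kernel t) (test_deriv 2 \<phi>)"
  have B0: "0 \<le> B" using order_trans[OF abs_ge_zero B] .
  have "\<bar>?H s - ?H t - (s - t) * ?G t\<bar> \<le> 3 / 2 * B * (s - t)\<^sup>2"
  proof (cases "s < t")
    case False
    then have "\<bar>?H (t + (s - t)) - ?H t - (s - t) * ?G t\<bar> \<le> B * (s - t)\<^sup>2 / 2"
      using st by (intro heat_kernel_increment(2) B) auto
    moreover have "B * (s - t)\<^sup>2 / 2 \<le> 3 / 2 * B * (s - t)\<^sup>2" using B0 by simp
    ultimately show ?thesis by simp
  next
    case True
    have 1: "\<bar>?H t - ?H s - (t - s) * ?G s\<bar> \<le> B * (t - s)\<^sup>2 / 2"
      using st True heat_kernel_increment(2)[of s "t - s" \<phi> B] B by simp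
    have "\<bar>?G t - ?G s\<bar> \<le> B * (t - s)"
      using st True heat_kernel_increment(1)[of s "t - s" "test_deriv 2 \<phi>" B] B
      by (simp add: test_deriv_add)
    then have "\<bar>(t - s) * (?G t - ?G s)\<bar> \<le> B * (t - s)\<^sup>2"
      using True mult_left_mono[of "\<bar>?G t - ?G s\<bar>" "B * (t - s)" "t - s"]
      by (simp add: abs_mult power2_eq_square mult_ac)
    then have 2: "\<bar>(t - s) * ?G t - (t - s) * ?G s\<bar> \<le> B * (t - s)\<^sup>2"
      by (simp only: right_diff_distrib)
    have 3: "(s - t) * ?G t = - ((t - s) * ?G t)" by (simp add: algebra_simps)
    have 4: "3 / 2 * B * (s - t)\<^sup>2 = B * (t - s)\<^sup>2 / 2 + B * (t - s)\<^sup>2"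
      by (simp add: power2_commute[of s t])
    show ?thesis using 1 2 unfolding 3 4 by linarith
  qed
  then have "\<bar>?H s - ?H t - (s - t) * ?G t\<bar> / \<bar>s - t\<bar> \<le> 3 / 2 * B * (s - t)\<^sup>2 / \<bar>s - t\<bar>"
    by (rule divide_right_mono) simp
  also have "3 / 2 * B * (s - t)\<^sup>2 / \<bar>s - t\<bar> = 3 / 2 * \<bar>s - t\<bar> * B"
  proof -
    have *: "3 / 2 * B * d\<^sup>2 / d = 3 / 2 * d * B" for d by (simp add: power2_eq_square)
    show ?thesis using *[of "\<bar>s - t\<bar>"] by simp
  qed
  also have "\<bar>?H s - ?H t - (s - t) * ?G t\<bar> / \<bar>s - t\<bar> = \<bar>(?H s - ?H t) / (s - t) - ?G t\<bar>"
    using st(3) by (simp add: abs_divide[symmetric] diff_divide_distrib)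
  finally show ?thesis .
qed

section \<open>Series with absolutely summable coefficients\<close>

text \<open>Dominated convergence for series, in the form in which continuity and differentiability
  of series are proved below.\<close>

lemma real_tannery:
  fixes f :: "nat \<Rightarrow> nat \<Rightarrow> real"
  assumes "\<And>l. (\<lambda>j. f l j) \<longlonglongrightarrow> g l" "\<And>l j. \<bar>f l j\<bar> \<le> M l" "summable M"
  shows "(\<lambda>j. \<Sum>l. f l j) \<longlonglongrightarrow> (\<Sum>l. g l)"
proof -
  have "\<forall>\<^sub>F (l, j) in sequentially \<times>\<^sub>F sequentially. norm (f l j) \<le> M l"
    by (intro always_eventually) (use assms(2) in auto)
  then show ?thesis using tannerys_theorem[OF assms(1) _ assms(3)] by simp
qed

lemma summable_mult_bounded:
  fixes a c :: "nat \<Rightarrow> real"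
  assumes "summable (\<lambda>i. \<bar>a i\<bar>)" "\<And>i. \<bar>c i\<bar> \<le> M"
  shows "summable (\<lambda>i. \<bar>a i * c i\<bar>)" "summable (\<lambda>i. a i * c i)"
proof -
  have "summable (\<lambda>i. M * \<bar>a i\<bar>)" by (intro summable_mult assms)
  moreover have "norm \<bar>a i * c i\<bar> \<le> M * \<bar>a i\<bar>" for i
    using mult_left_mono[OF assms(2)[of i], of "\<bar>a i\<bar>"] by (simp add: abs_mult mult.commute)
  ultimately show "summable (\<lambda>i. \<bar>a i * c i\<bar>)"
    by (rule summable_comparison_test'[where N = 0])
  then show "summable (\<lambda>i. a i * c i)" by (rule summable_rabs_cancel)
qed

lemma bounded_range_abs: "bounded (range (f :: 'a \<Rightarrow> real)) \<longleftrightarrow> (\<exists>M. \<forall>i. \<bar>f i\<bar> \<le> M)"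
  by (auto simp: bounded_iff)

section \<open>Weak-* convergence of bounded families\<close>

text \<open>Sokal's gliding hump: the index \<open>l n\<close> almost attains the norm \<open>\<ge> 4\<^sup>n\<close> of \<open>b (j n)\<close>, and the sign
  of the \<open>n\<close>-th coefficient \<open>\<plusminus>3\<^sup>-\<^sup>n\<close> is chosen so that the earlier terms do not cancel its
  contribution, while the later ones are too small to do so.\<close>

lemma l1_uniform_boundedness:
  fixes b :: "nat \<Rightarrow> 'i \<Rightarrow> real"
  assumes bdd: "\<And>j. bounded (range (b j))"
    and pw: "\<And>f a. summable (\<lambda>i. \<bar>a i\<bar>) \<Longrightarrow> Bseq (\<lambda>j. \<Sum>i. a i * b j (f i))"
  shows "\<exists>M. \<forall>j l. \<bar>b j l\<bar> \<le> M"
proof (rule ccontr)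
  assume unb: "\<nexists>M. \<forall>j l. \<bar>b j l\<bar> \<le> M"
  define N where "N = (\<lambda>j. SUP l. \<bar>b j l\<bar>)"
  have bddN: "bdd_above (range (\<lambda>l. \<bar>b j l\<bar>))" for j
    using bdd[of j] by (auto simp: bounded_range_abs bdd_above_def)
  have leN: "\<bar>b j l\<bar> \<le> N j" for j l
    unfolding N_def by (rule cSUP_upper[OF _ bddN]) simp
  \<comment> \<open>The fraction 2/3 must exceed 1/2: the terms after the \<open>n\<close>-th will
    contribute at most \<open>N (j n) * (1 / 3) ^ n / 2\<close>.\<close>
  have "\<exists>j l. 4 ^ n \<le> N j \<and> 2 / 3 * N j \<le> \<bar>b j l\<bar>" for n
  proof -
    obtain j l0 where "4 ^ n < \<bar>b j l0\<bar>" using unb by (meson not_le)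
    then have 4: "4 ^ n < N j" using leN[of j l0] by linarith
    then have "2 / 3 * N j < N j" using zero_less_power[of "4::real" n] by linarith
    then obtain l where "2 / 3 * N j < \<bar>b j l\<bar>"
      unfolding N_def using less_cSUP_iff[OF _ bddN, of "2 / 3 * N j" j] by (auto simp: N_def)
    then show ?thesis using 4 by (intro exI[of _ j] exI[of _ l]) auto
  qed
  then obtain j l where jl: "\<And>n. 4 ^ n \<le> N (j n)" "\<And>n. 2 / 3 * N (j n) \<le> \<bar>b (j n) (l n)\<bar>"
    by metis
  define c where "c = (\<lambda>n s. (if 0 \<le> s * b (j n) (l n) then 1 else - 1) / 3 ^ n :: real)"
  \<comment> \<open>\<open>S n m\<close> is the \<open>n\<close>-th partial sum for the family
    \<open>b m\<close>. It is kept as a function of \<open>m\<close> because the sign of the next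
    coefficient depends on its value at \<open>m = j n\<close>.\<close>
  define S where "S = rec_nat (\<lambda>_. 0) (\<lambda>n s m. s m + c n (s (j n)) * b m (l n))"
  define a where "a = (\<lambda>n. c n (S n (j n)))"
  have S: "S n m = (\<Sum>i<n. a i * b m (l i))" for n m
    by (induction n arbitrary: m) (auto simp: S_def a_def)
  have abs_a: "\<bar>a n\<bar> = (1 / 3) ^ n" for n by (simp add: a_def c_def power_one_over)
  have summ_a: "summable (\<lambda>i. \<bar>a i\<bar>)" unfolding abs_a by simp
  have hump: "\<bar>b (j n) (l n)\<bar> / 3 ^ n \<le> \<bar>S (Suc n) (j n)\<bar>" for n
  proof -
    have *: "\<bar>y\<bar> \<le> \<bar>x + (if 0 \<le> x * y then 1 else - 1) * y\<bar>" for x y :: real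
      by (auto simp: zero_le_mult_iff not_le mult_less_0_iff split: if_splits)
    have "S (Suc n) (j n) = S n (j n) + a n * b (j n) (l n)" by (simp add: S)
    also have "a n * b (j n) (l n) =
        (if 0 \<le> S n (j n) * (b (j n) (l n) / 3 ^ n) then 1 else - 1) * (b (j n) (l n) / 3 ^ n)"
      using zero_less_power[of "3::real" n]
      by (simp add: a_def c_def zero_le_divide_iff not_le[symmetric])
    finally show ?thesis using *[of "b (j n) (l n) / 3 ^ n" "S n (j n)"] by simp
  qed
  obtain C where C: "\<And>j. \<bar>\<Sum>i. a i * b j (l i)\<bar> \<le> C"
    using pw[OF summ_a, of l] by (auto simp: Bseq_def)
  have "(4 / 3) ^ n \<le> 6 * C" for n
  proof -
    let ?N = "N (j n)"
    let ?t = "\<lambda>i. a i * b (j n) (l i)"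
    have sm: "summable (\<lambda>i. \<bar>?t i\<bar>)" "summable ?t"
      using summable_mult_bounded[OF summ_a, of "\<lambda>i. b (j n) (l i)", OF leN] by auto
    have "\<bar>\<Sum>i. ?t (i + Suc n)\<bar> \<le> (\<Sum>i. \<bar>?t (i + Suc n)\<bar>)"
      by (intro summable_rabs summable_ignore_initial_segment[OF sm(1)])
    also have "\<dots> \<le> (\<Sum>i. ?N * (1 / 3) ^ Suc n * (1 / 3) ^ i)"
    proof (rule suminf_le)
      show "\<bar>?t (i + Suc n)\<bar> \<le> ?N * (1 / 3) ^ Suc n * (1 / 3) ^ i" for i
        using mult_left_mono[OF leN[of "j n" "l (i + Suc n)"], of "(1 / 3) ^ (i + Suc n)"]
        unfolding abs_mult abs_a by (simp add: power_add mult_ac)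
      show "summable (\<lambda>i. \<bar>?t (i + Suc n)\<bar>)"
        by (rule summable_ignore_initial_segment[OF sm(1)])
    qed (intro summable_mult summable_geometric; simp)
    also have "\<dots> = ?N * (1 / 3) ^ n / 2"
      by (subst suminf_mult) (auto simp: suminf_geometric)
    finally have tail: "\<bar>\<Sum>i. ?t (i + Suc n)\<bar> \<le> ?N * (1 / 3) ^ n / 2" .
    have "(\<Sum>i. ?t i) = (\<Sum>i. ?t (i + Suc n)) + S (Suc n) (j n)"
      unfolding S by (rule suminf_split_initial_segment[OF sm(2)])
    then have "\<bar>S (Suc n) (j n)\<bar> \<le> C + ?N * (1 / 3) ^ n / 2"
      using tail C[of "j n"] by linarith
    moreover have "2 / 3 * ?N * (1 / 3) ^ n \<le> \<bar>b (j n) (l n)\<bar> / 3 ^ n"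
      using mult_right_mono[OF jl(2)[of n], of "(1 / 3) ^ n"] by (simp add: power_one_over)
    \<comment> \<open>The hump has at least 2/3 and the tail at most 1/2 of
      \<open>N (j n) * (1 / 3) ^ n\<close>; the difference 1/6 gives the factor 6.\<close>
    ultimately have "?N * (1 / 3) ^ n \<le> 6 * C" using hump[of n] by (simp add: mult_ac)
    moreover have "4 ^ n * (1 / 3) ^ n \<le> ?N * (1 / 3) ^ n"
      by (intro mult_right_mono jl) auto
    moreover have "(4 / 3 :: real) ^ n = 4 ^ n * (1 / 3) ^ n" by (simp add: power_divide)
    ultimately show ?thesis by linarith
  qed
  moreover have "\<exists>n. 6 * C < (4 / 3 :: real) ^ n" by (rule real_arch_pow) simp
  ultimately show False by (meson not_le)
qed

text \<open>Convergent pairings are bounded, so uniform boundedness gives one \<open>M\<close> for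
  all members. It passes to the limit, and \<open>\<bar>a l\<bar> * M\<close> dominates the
  series.\<close>

lemma l1_weak_limit:
  fixes b :: "nat \<Rightarrow> 'i \<Rightarrow> real"
  assumes bdd: "\<And>j. bounded (range (b j))"
    and conv: "\<And>f a. summable (\<lambda>i. \<bar>a i\<bar>) \<Longrightarrow> convergent (\<lambda>j. \<Sum>i. a i * b j (f i))"
    and lim: "\<And>l. (\<lambda>j. b j l) \<longlonglongrightarrow> c l"
  shows "bounded (range c)"
    and "summable (\<lambda>i. \<bar>a i\<bar>) \<Longrightarrow> (\<lambda>j. \<Sum>i. a i * b j (f i)) \<longlonglongrightarrow> (\<Sum>i. a i * c (f i))"
proof -
  obtain M where M: "\<And>j l. \<bar>b j l\<bar> \<le> M"
    using l1_uniform_boundedness[of b] bdd conv convergent_imp_Bseq by blast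
  have "\<bar>c l\<bar> \<le> M" for l
    by (rule LIMSEQ_le_const2[OF tendsto_rabs[OF lim]]) (use M in auto)
  then show "bounded (range c)" by (auto simp: bounded_range_abs)
  assume a: "summable (\<lambda>i. \<bar>a i\<bar>)"
  show "(\<lambda>j. \<Sum>i. a i * b j (f i)) \<longlonglongrightarrow> (\<Sum>i. a i * c (f i))"
  proof (rule real_tannery)
    show "(\<lambda>j. a l * b j (f l)) \<longlonglongrightarrow> a l * c (f l)" for l by (intro tendsto_intros lim)
    show "\<bar>a l * b j (f l)\<bar> \<le> \<bar>a l\<bar> * M" for l j
      unfolding abs_mult by (intro mult_left_mono M) auto
    show "summable (\<lambda>l. \<bar>a l\<bar> * M)" by (intro summable_mult2 a)
  qed
qed

section \<open>Functions of class \<open>C\<^sup>k\<close>\<close>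

lemma Ck_on_imp_continuous: "Ck_on k n U f \<Longrightarrow> continuous_on U f"
  by (cases k) auto

lemma Ck_on_SucD: "Ck_on (Suc k) n U f \<Longrightarrow> Ck_on k n U f"
proof (induction k arbitrary: f)
  case (Suc k)
  then show ?case by (metis Ck_on.simps(2))
qed simp

lemma Ck_on_add:
  "Ck_on k n U f \<Longrightarrow> Ck_on k n U g \<Longrightarrow> Ck_on k n U (\<lambda>x. f x + g x)"
proof (induction k arbitrary: f g)
  case (Suc k)
  have "\<exists>h. Ck_on k n U h \<and>
      (\<forall>x\<in>U. ((\<lambda>t. f (x(i := t)) + g (x(i := t))) has_real_derivative h x) (at (x i)))"
    if i: "i < n" for i
  proof -
    obtain f' where f': "Ck_on k n U f'"
        "\<And>x. x \<in> U \<Longrightarrow> ((\<lambda>t. f (x(i := t))) has_real_derivative f' x) (at (x i))"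
      using Suc.prems(1) i by auto
    obtain g' where g': "Ck_on k n U g'"
        "\<And>x. x \<in> U \<Longrightarrow> ((\<lambda>t. g (x(i := t))) has_real_derivative g' x) (at (x i))"
      using Suc.prems(2) i by auto
    show ?thesis
      using Suc.IH[OF f'(1) g'(1)] f'(2) g'(2)
      by (intro exI[of _ "\<lambda>x. f' x + g' x"]) (auto intro!: DERIV_add)
  qed
  then show ?case
    using Suc.prems by (auto intro!: continuous_intros)
qed (auto intro!: continuous_intros)

lemma Ck_on_mult:
  "Ck_on k n U f \<Longrightarrow> Ck_on k n U g \<Longrightarrow> Ck_on k n U (\<lambda>x. f x * g x)"
proof (induction k arbitrary: f g)
  case (Suc k)
  have "\<exists>h. Ck_on k n U h \<and>
      (\<forall>x\<in>U. ((\<lambda>t. f (x(i := t)) * g (x(i := t))) has_real_derivative h x) (at (x i)))"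
    if i: "i < n" for i
  proof -
    obtain f' where f': "Ck_on k n U f'"
        "\<And>x. x \<in> U \<Longrightarrow> ((\<lambda>t. f (x(i := t))) has_real_derivative f' x) (at (x i))"
      using Suc.prems(1) i by auto
    obtain g' where g': "Ck_on k n U g'"
        "\<And>x. x \<in> U \<Longrightarrow> ((\<lambda>t. g (x(i := t))) has_real_derivative g' x) (at (x i))"
      using Suc.prems(2) i by auto
    have "Ck_on k n U (\<lambda>x. f' x * g x + g' x * f x)"
      by (intro Ck_on_add Suc.IH f' g' Ck_on_SucD[OF Suc.prems(1)] Ck_on_SucD[OF Suc.prems(2)])
    moreover have "((\<lambda>t. f (x(i := t)) * g (x(i := t))) has_real_derivative
        f' x * g x + g' x * f x) (at (x i))" if "x \<in> U" for x
      using DERIV_mult[OF f'(2)[OF that] g'(2)[OF that]] by simp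
    ultimately show ?thesis by blast
  qed
  then show ?case
    using Suc.prems by (auto intro!: continuous_intros)
qed (auto intro!: continuous_intros)

text \<open>The coordinate line is continuous into the product topology, and \<open>i < n\<close>
  keeps the coordinates from \<open>n\<close> on equal to 0.\<close>

lemma eventually_fun_upd_in_open:
  assumes U: "openin (Euclidean_space n) U" and x: "x \<in> U" and i: "i < n"
  shows "\<forall>\<^sub>F t in at (x i). x(i := t) \<in> U"
proof -
  obtain V where V: "open V" "U = V \<inter> {y. \<forall>i\<ge>n. y i = 0}"
    using U by (auto simp: Euclidean_space_def openin_subtopology euclidean_product_topology)
  have "continuous_on UNIV (\<lambda>t. x(i := t))"
  proof (rule continuous_on_coordinatewise_then_product)
    show "continuous_on UNIV (\<lambda>t. (x(i := t)) j)" for j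
      by (cases "j = i") (auto intro: continuous_intros)
  qed
  then have "((\<lambda>t. x(i := t)) \<longlongrightarrow> x(i := x i)) (at (x i))"
    unfolding continuous_on_def by blast
  then have "\<forall>\<^sub>F t in at (x i). x(i := t) \<in> V"
    using V x by (intro topological_tendstoD) auto
  then show ?thesis
    by (rule eventually_mono) (use V x i in auto)
qed

lemma partial_derivative_cong:
  assumes "openin (Euclidean_space n) U" "x \<in> U" "i < n" "\<And>y. y \<in> U \<Longrightarrow> f y = g y"
    and "((\<lambda>t. f (x(i := t))) has_real_derivative D) (at (x i))"
  shows "((\<lambda>t. g (x(i := t))) has_real_derivative D) (at (x i))"
proof -
  have "\<forall>\<^sub>F t in at (x i). f (x(i := t)) = g (x(i := t))"
    by (rule eventually_mono[OF eventually_fun_upd_in_open[OF assms(1-3)]]) (rule assms(4))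
  then show ?thesis
    using assms(2,4,5) has_field_derivative_cong_eventually[of "\<lambda>t. f (x(i := t))"
      "\<lambda>t. g (x(i := t))" "x i" UNIV D] by simp
qed

text \<open>No induction is involved: as \<open>U\<close> is open, the partial derivatives of
  \<open>f\<close> at points of \<open>U\<close> serve for \<open>g\<close>.\<close>

lemma Ck_on_cong:
  assumes U: "openin (Euclidean_space n) U" and eq: "\<And>x. x \<in> U \<Longrightarrow> f x = g x"
    and f: "Ck_on k n U f"
  shows "Ck_on k n U g"
proof (cases k)
  case 0
  then show ?thesis using f eq by (simp cong: continuous_on_cong)
next
  case (Suc l)
  have "continuous_on U g" using Ck_on_imp_continuous[OF f] eq by (simp cong: continuous_on_cong)
  then show ?thesis
    using f partial_derivative_cong[OF U _ _ eq] unfolding Suc by (simp, meson)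
qed

text \<open>The definition of \<open>Ck_on\<close> allows a different partial derivative for every
  \<open>k\<close>; by uniqueness of derivatives they agree on \<open>U\<close>, so one of them is
  of every class.\<close>

lemma smooth_on_partial:
  assumes U: "openin (Euclidean_space n) U" and f: "smooth_on n U f" and i: "i < n"
  obtains g where "smooth_on n U g"
    "\<And>x. x \<in> U \<Longrightarrow> ((\<lambda>t. f (x(i := t))) has_real_derivative g x) (at (x i))"
proof -
  have "\<exists>g. Ck_on k n U g \<and> (\<forall>x\<in>U. ((\<lambda>t. f (x(i := t))) has_real_derivative g x) (at (x i)))" for k
    using f i unfolding smooth_on_def by (metis Ck_on.simps(2))
  then obtain g where g: "\<And>k. Ck_on k n U (g k)"
    "\<And>k x. x \<in> U \<Longrightarrow> ((\<lambda>t. f (x(i := t))) has_real_derivative g k x) (at (x i))" by metis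
  have "Ck_on k n U (g 0)" for k
    by (rule Ck_on_cong[OF U _ g(1)[of k]]) (rule DERIV_unique[OF g(2) g(2)])
  then show thesis using that[of "g 0"] g(2) by (auto simp: smooth_on_def)
qed

lemma smooth_on_mult: "smooth_on n U f \<Longrightarrow> smooth_on n U g \<Longrightarrow> smooth_on n U (\<lambda>x. f x * g x)"
  by (simp add: smooth_on_def Ck_on_mult)

lemma smooth_on_cong:
  "openin (Euclidean_space n) U \<Longrightarrow> smooth_on n U f \<Longrightarrow> (\<And>x. x \<in> U \<Longrightarrow> f x = g x) \<Longrightarrow> smooth_on n U g"
  unfolding smooth_on_def using Ck_on_cong by blast

lemma smooth_on_imp_continuous: "smooth_on n U f \<Longrightarrow> continuous_on U f"
  unfolding smooth_on_def using Ck_on_imp_continuous by blast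

section \<open>Weak-* smooth families\<close>

text \<open>\<open>b\<close> is smooth on \<open>U\<close> as a map into \<open>\<l>\<^sup>\<infinity>\<close> with the topology of pointwise convergence on \<open>\<l>\<^sup>1\<close>.\<close>

definition weak_smooth :: "nat \<Rightarrow> (nat \<Rightarrow> real) set \<Rightarrow> ((nat \<Rightarrow> real) \<Rightarrow> 'i \<Rightarrow> real) \<Rightarrow> bool" where
  "weak_smooth n U b \<longleftrightarrow> (\<forall>x. bounded (range (b x))) \<and>
     (\<forall>f a. summable (\<lambda>i. \<bar>a i\<bar>) \<longrightarrow> smooth_on n U (\<lambda>x. \<Sum>i. a i * b x (f i)))"

lemma weak_smooth_bounded: "weak_smooth n U b \<Longrightarrow> bounded (range (b x))"
  by (simp add: weak_smooth_def)

lemma weak_smooth_series: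
  "weak_smooth n U b \<Longrightarrow> summable (\<lambda>i. \<bar>a i\<bar>) \<Longrightarrow> smooth_on n U (\<lambda>x. \<Sum>i. a i * b x (f i))"
  by (simp add: weak_smooth_def)

lemma suminf_indicator_0:
  fixes g :: "nat \<Rightarrow> real"
  shows "(\<Sum>i. (if i = 0 then 1 else 0) * g i) = g 0"
  by (subst suminf_finite[of "{0}"]) auto

lemma summable_indicator_0: "summable (\<lambda>i. \<bar>if i = (0::nat) then 1 else 0 :: real\<bar>)"
  by (rule summable_finite[of "{0}"]) auto

text \<open>Pairing with a unit vector: \<open>a\<close> is the indicator of 0 and \<open>f\<close>
  is constantly \<open>l\<close>.\<close>

lemma weak_smooth_component:
  assumes "weak_smooth n U b"
  shows "smooth_on n U (\<lambda>x. b x l)"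
  using weak_smooth_series[OF assms summable_indicator_0, of "\<lambda>_. l"]
  by (simp add: suminf_indicator_0)

lemma weak_smooth_mult:
  assumes b: "weak_smooth n U b" and v: "smooth_on n U v" and U: "openin (Euclidean_space n) U"
  shows "weak_smooth n U (\<lambda>x l. v x * b x l)"
  unfolding weak_smooth_def
proof (intro conjI allI impI)
  show "bounded (range (\<lambda>l. v x * b x l))" for x
    using bounded_scaling[OF weak_smooth_bounded[OF b, of x], of "v x"] by (simp add: image_image)
  fix f and a :: "nat \<Rightarrow> real"
  assume a: "summable (\<lambda>i. \<bar>a i\<bar>)"
  have "(\<Sum>i. a i * (v x * b x (f i))) = v x * (\<Sum>i. a i * b x (f i))" for x
  proof -
    obtain M where "\<And>l. \<bar>b x l\<bar> \<le> M"
      using weak_smooth_bounded[OF b, of x] by (auto simp: bounded_range_abs)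
    then have "summable (\<lambda>i. a i * b x (f i))" by (intro summable_mult_bounded(2)[OF a])
    from suminf_mult[OF this, of "v x"] show ?thesis by (simp add: mult_ac)
  qed
  then show "smooth_on n U (\<lambda>x. \<Sum>i. a i * (v x * b x (f i)))"
    using smooth_on_mult[OF v weak_smooth_series[OF b a, of f]] by simp
qed

section \<open>Difference quotients and partial derivatives of weak-* smooth families\<close>

text \<open>Derivatives are taken along sequences because the uniform boundedness principle above
  concerns sequences of families.\<close>

lemma DERIV_sequentially:
  assumes "(f has_real_derivative D) (at x)" "\<And>j. t j \<noteq> x" "t \<longlonglongrightarrow> x"
  shows "(\<lambda>j. (f (t j) - f x) / (t j - x)) \<longlonglongrightarrow> D"
  using assms unfolding has_field_derivative_iff tendsto_at_iff_sequentially comp_def by auto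

lemma DERIV_sequentiallyI:
  fixes f :: "real \<Rightarrow> real"
  assumes "\<And>t. (\<And>j. t j \<noteq> x) \<Longrightarrow> t \<longlonglongrightarrow> x \<Longrightarrow> (\<lambda>j. (f (t j) - f x) / (t j - x)) \<longlonglongrightarrow> D"
  shows "(f has_real_derivative D) (at x)"
  using assms unfolding has_field_derivative_iff tendsto_at_iff_sequentially comp_def by auto

text \<open>This supplies the hypotheses of \<open>l1_uniform_boundedness\<close> and
  \<open>l1_weak_limit\<close> for difference quotients. The bound of \<open>q j\<close> found here
  depends on \<open>j\<close>; uniformity comes only from that principle.\<close>

lemma weak_smooth_quotient:
  assumes b: "weak_smooth n U b" and U: "openin (Euclidean_space n) U"
    and x: "x \<in> U" and i: "i < n" and t: "\<And>j. t j \<noteq> x i" "t \<longlonglongrightarrow> x i"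
  defines "q \<equiv> \<lambda>j l. (b (x(i := t j)) l - b x l) / (t j - x i)"
  shows "bounded (range (q j))"
    and "summable (\<lambda>i. \<bar>a i\<bar>) \<Longrightarrow> ((\<lambda>s. \<Sum>k. a k * b (x(i := s)) (f k)) has_real_derivative D) (at (x i))
      \<Longrightarrow> (\<lambda>j. \<Sum>k. a k * q j (f k)) \<longlonglongrightarrow> D"
    and "summable (\<lambda>i. \<bar>a i\<bar>) \<Longrightarrow> convergent (\<lambda>j. \<Sum>k. a k * q j (f k))"
proof -
  show "bounded (range (q j))" for j
  proof -
    obtain M where M: "\<And>l. \<bar>b (x(i := t j)) l\<bar> \<le> M"
      using weak_smooth_bounded[OF b] unfolding bounded_range_abs by blast
    obtain N where N: "\<And>l. \<bar>b x l\<bar> \<le> N"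
      using weak_smooth_bounded[OF b] unfolding bounded_range_abs by blast
    have "\<bar>q j l\<bar> \<le> (M + N) / \<bar>t j - x i\<bar>" for l
      unfolding q_def abs_divide using M[of l] N[of l] by (intro divide_right_mono) auto
    then show ?thesis by (auto simp: bounded_range_abs)
  qed
  show lim: "(\<lambda>j. \<Sum>k. a k * q j (f k)) \<longlonglongrightarrow> D"
    if a: "summable (\<lambda>i. \<bar>a i\<bar>)"
      and D: "((\<lambda>s. \<Sum>k. a k * b (x(i := s)) (f k)) has_real_derivative D) (at (x i))" for a f D
  proof -
    have s: "summable (\<lambda>k. a k * b y (f k))" for y
    proof -
      obtain M where "\<And>l. \<bar>b y l\<bar> \<le> M"
        using weak_smooth_bounded[OF b, of y] by (auto simp: bounded_range_abs)
      then show ?thesis by (intro summable_mult_bounded(2)[OF a])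
    qed
    have "(\<Sum>k. a k * q j (f k)) =
        ((\<Sum>k. a k * b (x(i := t j)) (f k)) - (\<Sum>k. a k * b (x(i := x i)) (f k))) / (t j - x i)" for j
      using suminf_diff[OF s s, of "x(i := t j)" x]
        suminf_divide[OF summable_diff[OF s s], of "x(i := t j)" x "t j - x i"]
      by (simp add: q_def right_diff_distrib)
    then show ?thesis using DERIV_sequentially[OF D t] by simp
  qed
  assume a: "summable (\<lambda>i. \<bar>a i\<bar>)"
  obtain g where "\<And>x. x \<in> U \<Longrightarrow>
      ((\<lambda>s. \<Sum>k. a k * b (x(i := s)) (f k)) has_real_derivative g x) (at (x i))"
    using smooth_on_partial[OF U weak_smooth_series[OF b a, of f] i] by metis
  from lim[OF a this[OF x]] show "convergent (\<lambda>j. \<Sum>k. a k * q j (f k))"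
    by (rule convergentI)
qed

text \<open>The componentwise derivative is the weak-* limit of the difference quotients. Its
  pairings are thus the partial derivatives of the pairings of \<open>b\<close>, which are
  smooth.\<close>

lemma weak_smooth_partial:
  assumes b: "weak_smooth n U b" and U: "openin (Euclidean_space n) U" and i: "i < n"
  obtains b' where "weak_smooth n U b'"
    "\<And>x l. x \<in> U \<Longrightarrow> ((\<lambda>t. b (x(i := t)) l) has_real_derivative b' x l) (at (x i))"
proof -
  have "\<exists>g. \<forall>x\<in>U. ((\<lambda>t. b (x(i := t)) l) has_real_derivative g x) (at (x i))" for l
    using smooth_on_partial[OF U weak_smooth_component[OF b] i] by metis
  then obtain g where
    g: "\<And>l x. x \<in> U \<Longrightarrow> ((\<lambda>t. b (x(i := t)) l) has_real_derivative g l x) (at (x i))" by metis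
  \<comment> \<open>The value 0 off \<open>U\<close> is needed since \<open>weak_smooth\<close> asks
    for boundedness at every \<open>x\<close>.\<close>
  define b' where "b' = (\<lambda>x l. if x \<in> U then g l x else 0)"
  have bnd: "bounded (range (b' x))"
    and ser: "summable (\<lambda>i. \<bar>a i\<bar>) \<Longrightarrow> ((\<lambda>s. \<Sum>k. a k * b (x(i := s)) (f k)) has_real_derivative D) (at (x i))
      \<Longrightarrow> D = (\<Sum>k. a k * b' x (f k))" if x: "x \<in> U" for x f a D
  proof -
    \<comment> \<open>One sequence suffices: the derivatives are known to exist, and only their
      values and a bound are read off.\<close>
    define t where "t = (\<lambda>j. x i + inverse (real (Suc j)))"
    have t: "\<And>j. t j \<noteq> x i" "t \<longlonglongrightarrow> x i"
      using LIMSEQ_inverse_real_of_nat_add[of "x i"] by (auto simp: t_def)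
    have lim: "(\<lambda>j. (b (x(i := t j)) l - b x l) / (t j - x i)) \<longlonglongrightarrow> b' x l" for l
      using DERIV_sequentially[OF g[OF x] t] x by (simp add: b'_def)
    note q = weak_smooth_quotient[OF b U x i t]
    show "bounded (range (b' x))" by (rule l1_weak_limit(1)[OF q(1) q(3) lim])
    assume a: "summable (\<lambda>i. \<bar>a i\<bar>)"
      and D: "((\<lambda>s. \<Sum>k. a k * b (x(i := s)) (f k)) has_real_derivative D) (at (x i))"
    show "D = (\<Sum>k. a k * b' x (f k))"
      by (rule LIMSEQ_unique[OF q(2)[OF a D] l1_weak_limit(2)[OF q(1) q(3) lim a]])
  qed
  have "weak_smooth n U b'"
    unfolding weak_smooth_def
  proof (intro conjI allI impI)
    show "bounded (range (b' x))" for x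
      using bnd[of x] by (cases "x \<in> U") (auto simp: b'_def bounded_range_abs)
    fix f and a :: "nat \<Rightarrow> real"
    assume a: "summable (\<lambda>i. \<bar>a i\<bar>)"
    obtain h where h: "smooth_on n U h" "\<And>x. x \<in> U \<Longrightarrow>
        ((\<lambda>s. \<Sum>k. a k * b (x(i := s)) (f k)) has_real_derivative h x) (at (x i))"
      using smooth_on_partial[OF U weak_smooth_series[OF b a, of f] i] by metis
    show "smooth_on n U (\<lambda>x. \<Sum>k. a k * b' x (f k))"
      by (rule smooth_on_cong[OF U h(1)]) (rule ser[OF _ a h(2)])
  qed
  then show thesis using that[of b'] g by (auto simp: b'_def)
qed

text \<open>The \<open>k\<close>-th derivative in \<open>u\<close> of \<open>\<Sum>\<^sub>l w\<^sub>l sin(\<omega>\<^sub>l u) b\<^sub>l\<close>, by \<open>sin' = sin(\<cdot> + \<pi>/2)\<close>.\<close>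

definition osc_series ::
    "(nat \<Rightarrow> real) \<Rightarrow> (nat \<Rightarrow> real) \<Rightarrow> nat \<Rightarrow> real \<Rightarrow> (nat \<Rightarrow> real) \<Rightarrow> real" where
  "osc_series w \<omega> k u b = (\<Sum>l. w l * \<omega> l ^ k * (sin (\<omega> l * u + k * pi / 2) * b l))"

lemma abs_sin_mult_le: "\<bar>y\<bar> \<le> M \<Longrightarrow> \<bar>sin x * y\<bar> \<le> (M::real)"
  using mult_mono[OF abs_sin_le_one[of x] , of "\<bar>y\<bar>" M] by (simp add: abs_mult)

lemma abs_sin_diff_le: "\<bar>sin x - sin y\<bar> \<le> \<bar>x - y :: real\<bar>"
proof -
  have "\<bar>sin x - sin y\<bar> = 2 * (\<bar>sin ((x - y) / 2)\<bar> * \<bar>cos ((x + y) / 2)\<bar>)"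
    by (simp add: sin_diff_sin abs_mult)
  also have "\<dots> \<le> 2 * (\<bar>(x - y) / 2\<bar> * 1)"
    by (intro mult_left_mono mult_mono abs_sin_x_le_abs_x abs_cos_le_one) auto
  finally show ?thesis by simp
qed

lemma osc_series_summable:
  assumes "summable (\<lambda>l. \<bar>w l * \<omega> l ^ k\<bar>)" "bounded (range b)"
  shows "summable (\<lambda>l. w l * \<omega> l ^ k * (sin (\<omega> l * u + k * pi / 2) * b l))"
proof -
  obtain M where "\<And>l. \<bar>b l\<bar> \<le> M" using assms(2) by (auto simp: bounded_range_abs)
  then show ?thesis by (intro summable_mult_bounded(2)[OF assms(1)] abs_sin_mult_le)
qed

text \<open>Along a convergent sequence of points, uniform boundedness gives one \<open>M\<close>
  for all \<open>b (y j) l\<close>, so the series is dominated.\<close>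

lemma continuous_on_osc_series:
  assumes w: "summable (\<lambda>l. \<bar>w l * \<omega> l ^ k\<bar>)"
    and u: "continuous_on U u" and b: "weak_smooth n U b"
  shows "continuous_on U (\<lambda>x. osc_series w \<omega> k (u x) (b x))"
proof (rule continuous_on_sequentiallyI)
  fix y x assume y: "\<forall>j. y j \<in> U" and x: "x \<in> U" and lim: "y \<longlonglongrightarrow> x"
  have cont: "(\<lambda>j. f (y j)) \<longlonglongrightarrow> f x" if "continuous_on U f" for f :: "_ \<Rightarrow> real"
    using that y x lim unfolding continuous_on_sequentially comp_def by blast
  have blim: "(\<lambda>j. b (y j) l) \<longlonglongrightarrow> b x l" for l
    by (intro cont smooth_on_imp_continuous[OF weak_smooth_component[OF b]])
  have conv: "convergent (\<lambda>j. \<Sum>i. a i * b (y j) (f i))" if "summable (\<lambda>i. \<bar>a i\<bar>)" for a f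
    by (rule convergentI[OF cont[OF smooth_on_imp_continuous[OF weak_smooth_series[OF b that]]]])
  obtain M where M: "\<And>j l. \<bar>b (y j) l\<bar> \<le> M"
    using l1_uniform_boundedness[of "\<lambda>j. b (y j)"] weak_smooth_bounded[OF b] conv
      convergent_imp_Bseq by blast
  show "(\<lambda>j. osc_series w \<omega> k (u (y j)) (b (y j))) \<longlonglongrightarrow> osc_series w \<omega> k (u x) (b x)"
    unfolding osc_series_def
  proof (rule real_tannery)
    show "(\<lambda>j. w l * \<omega> l ^ k * (sin (\<omega> l * u (y j) + k * pi / 2) * b (y j) l)) \<longlonglongrightarrow>
        w l * \<omega> l ^ k * (sin (\<omega> l * u x + k * pi / 2) * b x l)" for l
      by (intro tendsto_intros cont u blim)
    show "\<bar>w l * \<omega> l ^ k * (sin (\<omega> l * u (y j) + k * pi / 2) * b (y j) l)\<bar>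
        \<le> \<bar>w l * \<omega> l ^ k\<bar> * M" for l j
      unfolding abs_mult[of "w l * \<omega> l ^ k"]
      by (intro mult_left_mono abs_sin_mult_le M) auto
    show "summable (\<lambda>l. \<bar>w l * \<omega> l ^ k\<bar> * M)" by (intro summable_mult2 w)
  qed
qed

text \<open>Termwise product rule. Uniform boundedness of the quotients of \<open>b\<close> provides
  the dominating series for the quotients of the terms.\<close>

lemma osc_series_partial:
  assumes w: "\<And>k. summable (\<lambda>l. \<bar>w l * \<omega> l ^ k\<bar>)"
    and U: "openin (Euclidean_space n) U" and x: "x \<in> U" and i: "i < n"
    and u: "((\<lambda>t. u (x(i := t))) has_real_derivative u') (at (x i))"
    and b: "weak_smooth n U b" and bb': "bounded (range b')"
    and b': "\<And>l. ((\<lambda>t. b (x(i := t)) l) has_real_derivative b' l) (at (x i))"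
  shows "((\<lambda>t. osc_series w \<omega> k (u (x(i := t))) (b (x(i := t)))) has_real_derivative
    osc_series w \<omega> (Suc k) (u x) (\<lambda>l. u' * b x l) + osc_series w \<omega> k (u x) b') (at (x i))"
proof (rule DERIV_sequentiallyI)
  fix t assume t: "\<And>j. t j \<noteq> x i" "t \<longlonglongrightarrow> x i"
  define s where "s = (\<lambda>l y. sin (\<omega> l * y + k * pi / 2))"
  define q where "q = (\<lambda>j l. (b (x(i := t j)) l - b x l) / (t j - x i))"
  define X where "X = (\<lambda>j. x(i := t j))"
  obtain M where M: "\<And>j l. \<bar>q j l\<bar> \<le> M"
    using l1_uniform_boundedness[of q] weak_smooth_quotient(1,3)[OF b U x i t]
      convergent_imp_Bseq unfolding q_def by blast
  obtain N where N: "\<And>l. \<bar>b x l\<bar> \<le> N"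
    using weak_smooth_bounded[OF b, of x] by (auto simp: bounded_range_abs)
  obtain A where A: "\<And>j. \<bar>t j - x i\<bar> \<le> A"
    using convergent_imp_Bseq[OF convergentI[OF tendsto_diff[OF t(2) tendsto_const]], of "x i"]
    by (auto simp: Bseq_def)
  obtain C where C: "\<And>j. \<bar>(u (X j) - u x) / (t j - x i)\<bar> \<le> C"
    using convergent_imp_Bseq[OF convergentI[OF DERIV_sequentially[OF u t]]]
    by (auto simp: Bseq_def X_def)
  have nn: "0 \<le> M" "0 \<le> A" "0 \<le> C" "0 \<le> N"
    using order_trans[OF abs_ge_zero M[of 0]] order_trans[OF abs_ge_zero A[of 0]]
      order_trans[OF abs_ge_zero C[of 0]] order_trans[OF abs_ge_zero N] by auto
  \<comment> \<open>The bound is uniform in \<open>j\<close>, since \<open>b (X j) l - b x l\<close>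
    is a bounded quotient times a bounded step.\<close>
  have bX: "\<bar>b (X j) l\<bar> \<le> N + M * A" for j l
  proof -
    have "b (X j) l = b x l + q j l * (t j - x i)" using t(1)[of j] by (simp add: q_def X_def)
    moreover have "\<bar>q j l * (t j - x i)\<bar> \<le> M * A"
      unfolding abs_mult using nn by (intro mult_mono M A) auto
    ultimately show ?thesis using N[of l] by linarith
  qed
  define Q where "Q = (\<lambda>l j. (s l (u (X j)) * b (X j) l - s l (u x) * b x l) / (t j - x i))"
  have Qlim: "Q l \<longlonglongrightarrow> \<omega> l * (sin (\<omega> l * u x + Suc k * pi / 2) * (u' * b x l)) + s l (u x) * b' l" for l
  proof -
    have sin_shift: "cos (\<omega> l * u x + k * pi / 2) = sin (\<omega> l * u x + Suc k * pi / 2)"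
      by (simp add: sin_add cos_add add_divide_distrib distrib_right algebra_simps)
    have "((\<lambda>t. s l (u (x(i := t)))) has_real_derivative
        cos (\<omega> l * u x + k * pi / 2) * (\<omega> l * u')) (at (x i))"
      using DERIV_fun_sin[OF DERIV_add[OF DERIV_cmult[OF u, of "\<omega> l"] DERIV_const[of "k * pi / 2"]]]
      by (simp add: s_def)
    from DERIV_mult[OF this b'[of l]]
    have "((\<lambda>t. s l (u (x(i := t))) * b (x(i := t)) l) has_real_derivative
        cos (\<omega> l * u x + k * pi / 2) * (\<omega> l * u') * b x l + b' l * s l (u x)) (at (x i))"
      by simp
    from DERIV_sequentially[OF this t] show ?thesis
      unfolding Q_def X_def sin_shift by (simp add: mult_ac)
  qed
  \<comment> \<open>The quotient is split as in the product rule. The sine is 1-Lipschitz, so its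
    part costs a factor \<open>\<bar>\<omega> l\<bar>\<close>, paid for by summability at exponent
    \<open>Suc k\<close>.\<close>
  have Qbound: "\<bar>Q l j\<bar> \<le> \<bar>\<omega> l\<bar> * (C * (N + M * A)) + M" for l j
  proof -
    have "\<bar>s l (u (X j)) - s l (u x)\<bar> \<le> \<bar>\<omega> l * u (X j) - \<omega> l * u x\<bar>"
      unfolding s_def using abs_sin_diff_le[of "\<omega> l * u (X j) + k * pi / 2" "\<omega> l * u x + k * pi / 2"]
      by simp
    then have "\<bar>(s l (u (X j)) - s l (u x)) / (t j - x i)\<bar> \<le> \<bar>\<omega> l\<bar> * \<bar>(u (X j) - u x) / (t j - x i)\<bar>"
      using divide_right_mono[of _ _ "\<bar>t j - x i\<bar>"]
      by (simp add: abs_mult abs_divide right_diff_distrib[symmetric])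
    also have "\<dots> \<le> \<bar>\<omega> l\<bar> * C" by (intro mult_left_mono C) auto
    finally have "\<bar>(s l (u (X j)) - s l (u x)) / (t j - x i) * b (X j) l\<bar> \<le> \<bar>\<omega> l\<bar> * C * (N + M * A)"
      unfolding abs_mult using nn by (intro mult_mono bX) auto
    moreover have "\<bar>s l (u x) * q j l\<bar> \<le> M" unfolding s_def by (rule abs_sin_mult_le[OF M])
    moreover have "Q l j = (s l (u (X j)) - s l (u x)) / (t j - x i) * b (X j) l + s l (u x) * q j l"
      by (simp add: Q_def q_def X_def diff_divide_distrib left_diff_distrib right_diff_distrib)
    ultimately have "\<bar>Q l j\<bar> \<le> \<bar>\<omega> l\<bar> * C * (N + M * A) + M" by linarith
    then show ?thesis by (simp only: mult.assoc)
  qed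
  let ?v = "\<lambda>l. w l * \<omega> l ^ k"
  have "(\<lambda>j. \<Sum>l. ?v l * Q l j) \<longlonglongrightarrow>
      (\<Sum>l. ?v l * (\<omega> l * (sin (\<omega> l * u x + Suc k * pi / 2) * (u' * b x l)) + s l (u x) * b' l))"
  proof (rule real_tannery)
    show "\<bar>?v l * Q l j\<bar> \<le> \<bar>w l * \<omega> l ^ Suc k\<bar> * (C * (N + M * A)) + \<bar>?v l\<bar> * M" for l j
      using mult_left_mono[OF Qbound[of l j], of "\<bar>?v l\<bar>"] by (simp add: abs_mult algebra_simps)
    show "summable (\<lambda>l. \<bar>w l * \<omega> l ^ Suc k\<bar> * (C * (N + M * A)) + \<bar>?v l\<bar> * M)"
      by (intro summable_add summable_mult2 w)
  qed (intro tendsto_intros Qlim)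
  also have "(\<Sum>l. ?v l * (\<omega> l * (sin (\<omega> l * u x + Suc k * pi / 2) * (u' * b x l)) + s l (u x) * b' l)) =
      osc_series w \<omega> (Suc k) (u x) (\<lambda>l. u' * b x l) + osc_series w \<omega> k (u x) b'"
    unfolding osc_series_def s_def
    by (subst suminf_add[OF osc_series_summable[OF w] osc_series_summable[OF w bb']])
      (use bounded_scaling[OF weak_smooth_bounded[OF b, of x], of u'] in
        \<open>auto simp: image_image algebra_simps\<close>)
  also have "(\<lambda>j. \<Sum>l. ?v l * Q l j) = (\<lambda>j. (osc_series w \<omega> k (u (X j)) (b (X j)) -
      osc_series w \<omega> k (u x) (b x)) / (t j - x i))"
  proof
    fix j
    note sm = osc_series_summable[OF w[of k] weak_smooth_bounded[OF b], of "u (X j)" "X j"]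
      osc_series_summable[OF w[of k] weak_smooth_bounded[OF b], of "u x" x]
    show "(\<Sum>l. ?v l * Q l j) = (osc_series w \<omega> k (u (X j)) (b (X j)) -
        osc_series w \<omega> k (u x) (b x)) / (t j - x i)"
      unfolding osc_series_def suminf_diff[OF sm] suminf_divide[OF summable_diff[OF sm], symmetric]
      by (simp add: Q_def s_def right_diff_distrib)
  qed
  finally show "(\<lambda>j. (osc_series w \<omega> k (u (x(i := t j))) (b (x(i := t j))) -
      osc_series w \<omega> k (u (x(i := x i))) (b (x(i := x i)))) / (t j - x i)) \<longlonglongrightarrow>
    osc_series w \<omega> (Suc k) (u x) (\<lambda>l. u' * b x l) + osc_series w \<omega> k (u x) b'"
    by (simp add: X_def)
qed

text \<open>A partial derivative is a sum of two series of the same kind, with data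
  \<open>Suc k\<close>, \<open>u' * b\<close> and \<open>k\<close>, \<open>b'\<close>. Hence the
  induction on the class leaves \<open>k\<close> and \<open>b\<close> arbitrary.\<close>

lemma smooth_on_osc_series:
  assumes w: "\<And>k. summable (\<lambda>l. \<bar>w l * \<omega> l ^ k\<bar>)"
    and U: "openin (Euclidean_space n) U" and u: "smooth_on n U u" and b: "weak_smooth n U b"
  shows "smooth_on n U (\<lambda>x. osc_series w \<omega> k (u x) (b x))"
proof -
  have "Ck_on r n U (\<lambda>x. osc_series w \<omega> k (u x) (b x))" for r
    using b
  proof (induction r arbitrary: k b)
    case 0
    then show ?case
      using continuous_on_osc_series[OF w smooth_on_imp_continuous[OF u]] by simp
  next
    case (Suc r)
    have "\<exists>g. Ck_on r n U g \<and> (\<forall>x\<in>U. ((\<lambda>t. osc_series w \<omega> k (u (x(i := t))) (b (x(i := t))))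
        has_real_derivative g x) (at (x i)))" if i: "i < n" for i
    proof -
      obtain u' where u': "smooth_on n U u'"
        "\<And>x. x \<in> U \<Longrightarrow> ((\<lambda>t. u (x(i := t))) has_real_derivative u' x) (at (x i))"
        using smooth_on_partial[OF U u i] by metis
      obtain b' where b': "weak_smooth n U b'"
        "\<And>x l. x \<in> U \<Longrightarrow> ((\<lambda>t. b (x(i := t)) l) has_real_derivative b' x l) (at (x i))"
        using weak_smooth_partial[OF Suc.prems U i] by metis
      have "Ck_on r n U (\<lambda>x. osc_series w \<omega> (Suc k) (u x) (\<lambda>l. u' x * b x l) +
          osc_series w \<omega> k (u x) (b' x))"
        by (intro Ck_on_add Suc.IH weak_smooth_mult Suc.prems u' b' U)
      moreover have "((\<lambda>t. osc_series w \<omega> k (u (x(i := t))) (b (x(i := t)))) has_real_derivative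
          osc_series w \<omega> (Suc k) (u x) (\<lambda>l. u' x * b x l) + osc_series w \<omega> k (u x) (b' x)) (at (x i))"
        if x: "x \<in> U" for x
        by (rule osc_series_partial[OF w U x i u'(2)[OF x] Suc.prems weak_smooth_bounded[OF b'(1)]
            b'(2)[OF x]])
      ultimately show ?thesis by blast
    qed
    moreover have "continuous_on U (\<lambda>x. osc_series w \<omega> k (u x) (b x))"
      by (rule continuous_on_osc_series[OF w smooth_on_imp_continuous[OF u] Suc.prems])
    ultimately show ?case by simp
  qed
  then show ?thesis by (simp add: smooth_on_def)
qed

section \<open>Bounded families of distributions\<close>

definition dist_series :: "(nat \<Rightarrow> real) \<Rightarrow> (nat \<Rightarrow> distribution) \<Rightarrow> distribution" where
  "dist_series a T = Abs_distribution (\<lambda>\<phi>. \<Sum>l. a l * dist_apply (T l) \<phi>)"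

lemma bounded_dist_apply:
  assumes T: "\<And>l. order_bound m C (T l)"
  shows "\<exists>M. \<forall>l. \<bar>dist_apply (T l) \<phi>\<bar> \<le> M"
  using bounded_derivatives[of m \<phi>] T unfolding order_bound_def by metis

text \<open>The series has order bound \<open>(\<Sum>l. \<bar>a l\<bar>) * C\<close> of the same
  order \<open>m\<close>, so it is a distribution and \<open>Abs_distribution\<close> is applied
  legitimately.\<close>

lemma dist_apply_dist_series:
  assumes a: "summable (\<lambda>l. \<bar>a l\<bar>)" and T: "\<And>l. order_bound m C (T l)"
  shows "dist_apply (dist_series a T) \<phi> = (\<Sum>l. a l * dist_apply (T l) \<phi>)"
proof -
  let ?S = "\<lambda>\<phi>. \<Sum>l. a l * dist_apply (T l) \<phi>"
  have sm: "summable (\<lambda>l. a l * dist_apply (T l) \<phi>)" for \<phi>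
  proof -
    obtain M where "\<And>l. \<bar>dist_apply (T l) \<phi>\<bar> \<le> M"
      using bounded_dist_apply[of m C T \<phi>, OF T] by blast
    then show ?thesis by (rule summable_mult_bounded(2)[OF a])
  qed
  have lin: "linear ?S"
  proof (rule linearI)
    show "?S (\<phi> + \<psi>) = ?S \<phi> + ?S \<psi>" for \<phi> \<psi>
      using suminf_add[OF sm sm, of \<phi> \<psi>]
      by (simp add: linear_add[OF linear_dist_apply] distrib_left)
    show "?S (c *\<^sub>R \<phi>) = c *\<^sub>R ?S \<phi>" for c \<phi>
      using suminf_mult[OF sm, of c \<phi>]
      by (simp add: linear_scale[OF linear_dist_apply] mult.left_commute)
  qed
  have "\<bar>?S \<phi>\<bar> \<le> (\<Sum>l. \<bar>a l\<bar>) * C * B" if B: "\<And>k x. k \<le> m \<Longrightarrow> \<bar>(deriv ^^ k) (fun_of \<phi>) x\<bar> \<le> B" for \<phi> B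
  proof -
    have le: "\<bar>dist_apply (T l) \<phi>\<bar> \<le> C * B" for l
      using T[of l] B by (auto simp: order_bound_def)
    have sa: "summable (\<lambda>l. \<bar>a l * dist_apply (T l) \<phi>\<bar>)" by (rule summable_mult_bounded(1)[OF a le])
    have "\<bar>?S \<phi>\<bar> \<le> (\<Sum>l. \<bar>a l * dist_apply (T l) \<phi>\<bar>)" by (rule summable_rabs[OF sa])
    also have "\<dots> \<le> (\<Sum>l. \<bar>a l\<bar> * (C * B))"
    proof (rule suminf_le)
      show "\<bar>a l * dist_apply (T l) \<phi>\<bar> \<le> \<bar>a l\<bar> * (C * B)" for l
        unfolding abs_mult by (intro mult_left_mono le) simp
    qed (intro sa summable_mult2 a)+
    also have "\<dots> = (\<Sum>l. \<bar>a l\<bar>) * C * B" by (simp add: suminf_mult2[OF a, symmetric] mult.assoc)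
    finally show ?thesis .
  qed
  from continuous_on_test_fun_order_bound[OF lin this] have "continuous_on UNIV ?S" .
  then show ?thesis using lin by (simp add: dist_series_def Abs_distribution_inverse)
qed

text \<open>A plot of test functions is smooth against every distribution, in particular against
  each absolutely summable combination of the \<open>T (f i)\<close>.\<close>

lemma weak_smooth_test_plot:
  assumes p: "test_plot n U p" and T: "\<And>l. order_bound m C (T l)"
  shows "weak_smooth n U (\<lambda>x l. dist_apply (T l) (p x))"
  unfolding weak_smooth_def
proof (intro conjI allI impI)
  show "bounded (range (\<lambda>l. dist_apply (T l) (p x)))" for x
    using bounded_dist_apply[of m C T, OF T] by (simp add: bounded_range_abs)
  fix f and a :: "nat \<Rightarrow> real" assume a: "summable (\<lambda>i. \<bar>a i\<bar>)"
  have "smooth_on n U (dist_apply (dist_series a (\<lambda>i. T (f i))) \<circ> p)"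
    using p by (simp add: test_plot_def)
  then show "smooth_on n U (\<lambda>x. \<Sum>i. a i * dist_apply (T (f i)) (p x))"
    by (simp add: comp_def dist_apply_dist_series[of a m C "\<lambda>i. T (f i)", OF a T])
qed

text \<open>Evaluated on a plot of pairs, the curve becomes an \<open>osc_series\<close> whose
  argument is the first component and whose weak-* smooth family comes from the second.\<close>

lemma dist_plot_osc_curve:
  assumes w: "\<And>k. summable (\<lambda>l. \<bar>w l * \<omega> l ^ k\<bar>)" and T: "\<And>l. order_bound m C (T l)"
  shows "dist_plot 1 (topspace (Euclidean_space 1)) (\<lambda>x. dist_series (\<lambda>l. w l * sin (\<omega> l * x 0)) T)"
  unfolding dist_plot_def smooth_function_def prod_plot_def
proof (intro conjI allI impI openin_topspace)
  fix n V and p :: "(nat \<Rightarrow> real) \<Rightarrow> (nat \<Rightarrow> real) \<times> test_fun"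
  assume "open_plot 1 (topspace (Euclidean_space 1)) n V (fst \<circ> p) \<and> test_plot n V (snd \<circ> p)"
  then have V: "openin (Euclidean_space n) V" and u: "smooth_on n V (\<lambda>x. fst (p x) 0)"
    and p: "test_plot n V (\<lambda>x. snd (p x))"
    by (auto simp: open_plot_def comp_def)
  have "summable (\<lambda>l. \<bar>w l * sin (\<omega> l * y)\<bar>)" for y
    using summable_mult_bounded(1)[of w "\<lambda>l. sin (\<omega> l * y)" 1] w[of 0] abs_sin_le_one by simp
  then have "dist_apply (dist_series (\<lambda>l. w l * sin (\<omega> l * y)) T) \<phi> =
      osc_series w \<omega> 0 y (\<lambda>l. dist_apply (T l) \<phi>)" for y \<phi>
    by (simp add: dist_apply_dist_series[of _ m C T, OF _ T] osc_series_def mult.assoc)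
  then show "smooth_on n V ((\<lambda>(x, \<phi>). dist_apply (dist_series (\<lambda>l. w l * sin (\<omega> l * x 0)) T) \<phi>) \<circ> p)"
    using smooth_on_osc_series[OF w V u weak_smooth_test_plot[of n V _ m C T, OF p T], of 0]
    by (simp add: comp_def case_prod_beta)
qed

text \<open>Up to the factor \<open>pi ^ k\<close> this is the exponential series at
  \<open>2 ^ k\<close>.\<close>

lemma summable_osc_weights: "summable (\<lambda>l. \<bar>1 / fact l * (2 ^ l * pi) ^ k :: real\<bar>)"
proof -
  have "\<bar>1 / fact l * (2 ^ l * pi) ^ k\<bar> = pi ^ k * (inverse (fact l) * (2 ^ k) ^ l)" for l
  proof -
    have "(2 ^ l * pi) ^ k = pi ^ k * (2 ^ k) ^ l"
      by (simp add: power_mult_distrib power_mult[symmetric] mult.commute)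
    then show ?thesis by (simp add: divide_inverse)
  qed
  then show ?thesis using summable_mult[OF summable_exp[of "2 ^ k :: real"], of "pi ^ k"] by simp
qed

lemma dist_apply_sum: "dist_apply (\<Sum>l\<in>A. T l) \<phi> = (\<Sum>l\<in>A. dist_apply (T l) \<phi>)"
  by (induction A rule: infinite_finite_induct)
    (simp_all add: zero_distribution.rep_eq plus_distribution.rep_eq)

text \<open>The angle is pi times a power of 2: an integer multiple of pi for \<open>l > j\<close>,
  exactly \<open>pi / 2\<close> for \<open>l = j\<close>, and smaller but positive for
  \<open>l < j\<close>.\<close>

lemma sin_dyadic:
  fixes j l :: nat
  shows "j < l \<Longrightarrow> sin (2 ^ l * pi * (1 / 2) ^ Suc j) = 0"
    and "l \<le> j \<Longrightarrow> 0 \<le> sin (2 ^ l * pi * (1 / 2) ^ Suc j)"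
    and "sin (2 ^ j * pi * (1 / 2) ^ Suc j) = 1"
proof -
  let ?s = "(1 / 2 :: real) ^ Suc j"
  have js: "2 ^ j * ?s = 1 / 2" by (simp add: power_one_over)
  {
    assume "j < l"
    then obtain d where d: "l = Suc j + d" using less_imp_Suc_add by auto
    have "2 ^ l * pi * ?s = real (2 ^ d) * pi"
      unfolding d power_add by (simp add: power_one_over)
    then show "sin (2 ^ l * pi * ?s) = 0" by (simp only: sin_npi)
  next
    assume "l \<le> j"
    then have "2 ^ l * ?s \<le> 2 ^ j * ?s" by (intro mult_right_mono power_increasing) auto
    then have "2 ^ l * ?s \<le> 1" using js by linarith
    then have "2 ^ l * ?s * pi \<le> 1 * pi" by (rule mult_right_mono) simp
    then have "2 ^ l * pi * ?s \<le> pi" by (simp only: mult_ac mult_1_left)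
    then show "0 \<le> sin (2 ^ l * pi * ?s)" by (intro sin_ge_zero) auto
  }
  have "2 ^ j * pi * ?s = pi / 2" using js by (simp only: mult_ac times_divide_eq_right mult_1_right)
  then show "sin (2 ^ j * pi * ?s) = 1" by (simp only: sin_pi_half)
qed

text \<open>If \<open>\<Phi>\<close> were unbounded, there would be \<open>T\<^sub>l\<close> in the unit ball with \<open>\<Phi> T\<^sub>l = l l!\<close>. As
  \<open>sin (2\<^sup>l \<pi> s)\<close> vanishes at \<open>s = 2\<^sup>-\<^sup>j\<close> for \<open>l \<ge> j\<close>, the smooth curve
  \<open>\<Sum>\<^sub>l sin (2\<^sup>l \<pi> s) / l! T\<^sub>l\<close> is a finite sum at these points, where \<open>\<Phi>\<close> is unbounded on it.\<close>

lemma smooth_dual_bounded: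
  assumes \<Phi>: "\<Phi> \<in> smooth_dual dist_plot"
  shows "\<exists>M. \<forall>T C. 0 < C \<longrightarrow> order_bound m C T \<longrightarrow> \<bar>\<Phi> T\<bar> \<le> M * C"
proof -
  have lin: "linear \<Phi>" and sm: "smooth_function dist_plot \<Phi>" using \<Phi> by (auto simp: smooth_dual_def)
  have "\<exists>M. \<forall>T. order_bound m 1 T \<longrightarrow> \<bar>\<Phi> T\<bar> \<le> M"
  proof (rule ccontr)
    assume unb: "\<nexists>M. \<forall>T. order_bound m 1 T \<longrightarrow> \<bar>\<Phi> T\<bar> \<le> M"
    \<comment> \<open>An element of the unit ball with too large a value is scaled down, which keeps
      it in the ball and attains \<open>r\<close> exactly.\<close>
    have "\<exists>T. order_bound m 1 T \<and> \<Phi> T = r" if r: "0 \<le> r" for r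
    proof -
      obtain T where T: "order_bound m 1 T" "r < \<bar>\<Phi> T\<bar>" using unb by (meson not_le)
      have c: "\<bar>r / \<Phi> T\<bar> \<le> 1" using T(2) r by (simp add: abs_divide divide_le_eq)
      have "order_bound m 1 ((r / \<Phi> T) *\<^sub>R T)"
        unfolding order_bound_def
      proof (intro allI impI)
        fix \<phi> B assume B: "\<forall>k\<le>m. \<forall>x. \<bar>(deriv ^^ k) (fun_of \<phi>) x\<bar> \<le> B"
        then have "\<bar>dist_apply T \<phi>\<bar> \<le> B" using T(1) by (auto simp: order_bound_def)
        then show "\<bar>dist_apply ((r / \<Phi> T) *\<^sub>R T) \<phi>\<bar> \<le> 1 * B"
          unfolding scaleR_distribution.rep_eq abs_mult using c by (intro mult_mono) auto
      qed
      moreover have "\<Phi> ((r / \<Phi> T) *\<^sub>R T) = r" using T(2) r by (simp add: linear_scale[OF lin])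
      ultimately show ?thesis by blast
    qed
    then have "\<exists>T. order_bound m 1 T \<and> \<Phi> T = real l * fact l" for l by simp
    then obtain T where T: "\<And>l. order_bound m 1 (T l)" "\<And>l. \<Phi> (T l) = real l * fact l" by metis
    define w where "w = (\<lambda>l. 1 / fact l :: real)"
    define \<omega> where "\<omega> = (\<lambda>l. 2 ^ l * pi)"
    define c where "c = (\<lambda>s. dist_series (\<lambda>l. w l * sin (\<omega> l * s)) T)"
    have w: "summable (\<lambda>l. \<bar>w l * \<omega> l ^ k\<bar>)" for k
      unfolding w_def \<omega>_def by (rule summable_osc_weights)
    have "smooth_on 1 (topspace (Euclidean_space 1)) (\<Phi> \<circ> (\<lambda>x. c (x 0)))"
      using sm dist_plot_osc_curve[of w \<omega> m 1 T, OF w T(1)] unfolding smooth_function_def c_def by blast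
    then have "continuous_on (topspace (Euclidean_space 1)) (\<lambda>x. \<Phi> (c (x 0)))"
      by (drule_tac smooth_on_imp_continuous) (simp add: comp_def)
    \<comment> \<open>The real line is embedded as the axis of coordinate 0, which turns continuity
      on \<open>Euclidean_space 1\<close> into continuity in \<open>s\<close>.\<close>
    moreover have "continuous_on UNIV (\<lambda>s i. if i = (0::nat) then s else 0 :: real)"
    proof (rule continuous_on_coordinatewise_then_product)
      show "continuous_on UNIV (\<lambda>s. if i = (0::nat) then s else 0 :: real)" for i
        by (cases "i = 0") (auto intro: continuous_intros)
    qed
    ultimately have "continuous_on UNIV (\<lambda>s. \<Phi> (c (if (0::nat) = 0 then s else 0)))"
      by (rule continuous_on_compose2) (auto simp: topspace_Euclidean_space)
    then have "bounded ((\<lambda>s. \<Phi> (c s)) ` {0..1})"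
      by (intro compact_imp_bounded compact_continuous_image) (auto intro: continuous_on_subset)
    then obtain K where "\<forall>s\<in>{0..1}. \<bar>\<Phi> (c s)\<bar> \<le> K" by (auto simp: bounded_iff)
    then have K: "0 \<le> s \<Longrightarrow> s \<le> 1 \<Longrightarrow> \<bar>\<Phi> (c s)\<bar> \<le> K" for s by simp
    have "real j \<le> K" for j
    proof -
      define s where "s = (1 / 2 :: real) ^ Suc j"
      have s01: "0 \<le> s" "s \<le> 1" unfolding s_def by (rule zero_le_power, simp, rule power_le_one) auto
      note sin = sin_dyadic[where j = j, folded s_def]
      have sa: "summable (\<lambda>l. \<bar>w l * sin (\<omega> l * s)\<bar>)"
        using summable_mult_bounded(1)[of w "\<lambda>l. sin (\<omega> l * s)" 1] w[of 0] abs_sin_le_one by simp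
      \<comment> \<open>Linearity does not let \<open>\<Phi>\<close> pass through an infinite
        series; at this \<open>s\<close> only finitely many terms survive, so it applies.\<close>
      have "c s = (\<Sum>l\<in>{..j}. (w l * sin (\<omega> l * s)) *\<^sub>R T l)"
      proof (rule dist_apply_inject[THEN iffD1], rule ext)
        fix \<phi>
        have "dist_apply (c s) \<phi> = (\<Sum>l\<in>{..j}. w l * sin (\<omega> l * s) * dist_apply (T l) \<phi>)"
          unfolding c_def dist_apply_dist_series[of _ m 1 T, OF sa T(1)]
          by (rule suminf_finite) (auto simp: \<omega>_def sin(1))
        then show "dist_apply (c s) \<phi> = dist_apply (\<Sum>l\<in>{..j}. (w l * sin (\<omega> l * s)) *\<^sub>R T l) \<phi>"
          unfolding dist_apply_sum scaleR_distribution.rep_eq .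
      qed
      then have "\<Phi> (c s) = (\<Sum>l\<in>{..j}. w l * sin (\<omega> l * s) * \<Phi> (T l))"
        by (simp only: linear_sum[OF lin] linear_scale[OF lin] real_scaleR_def)
      also have "\<dots> = (\<Sum>l\<in>{..j}. real l * sin (\<omega> l * s))"
        by (intro sum.cong refl) (simp add: T(2) w_def)
      \<comment> \<open>All summands are nonnegative by \<open>sin(2)\<close>, and the one with
        \<open>l = j\<close> has the value \<open>real j\<close>.\<close>
      also have "\<dots> \<ge> real j * sin (\<omega> j * s)"
        by (rule member_le_sum) (auto simp: \<omega>_def intro!: mult_nonneg_nonneg sin(2))
      finally show ?thesis using K[OF s01] sin(3) by (simp add: \<omega>_def)
    qed
    then show False by (meson reals_Archimedean2 not_le)
  qed
  then obtain M where M: "\<And>T. order_bound m 1 T \<Longrightarrow> \<bar>\<Phi> T\<bar> \<le> M" by blast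
  have "\<bar>\<Phi> T\<bar> \<le> M * C" if C: "0 < C" and T: "order_bound m C T" for T C
  proof -
    have "order_bound m 1 (inverse C *\<^sub>R T)"
      using order_bound_scaleR[OF T, of "inverse C"] C by simp
    then have "\<bar>\<Phi> (inverse C *\<^sub>R T)\<bar> \<le> M" by (rule M)
    then have "\<bar>\<Phi> T\<bar> / C \<le> M" using C by (simp add: linear_scale[OF lin] abs_mult divide_inverse_commute)
    then show ?thesis using C by (simp add: divide_le_eq)
  qed
  then show ?thesis by blast
qed

section \<open>Strong smoothness of the heat kernel\<close>

text \<open>By the heat equation each time derivative of the kernel amounts to two space
  derivatives, moved here onto the test function. This makes sense at \<open>t = 0\<close>
  too.\<close>

lift_definition heat_deriv :: "nat \<Rightarrow> real \<Rightarrow> distribution" is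
  "\<lambda>k t \<phi>. dist_apply (heat_kernel t) (test_deriv (2 * k) \<phi>)"
proof
  fix k t
  let ?T = "\<lambda>\<phi>. dist_apply (heat_kernel t) (test_deriv (2 * k) \<phi>)"
  show lin: "linear ?T"
    by (rule linear_compose[OF linear_test_deriv linear_dist_apply, unfolded comp_def])
  have "\<bar>?T \<phi>\<bar> \<le> 1 * B" if B: "\<And>j x. j \<le> 2 * k \<Longrightarrow> \<bar>(deriv ^^ j) (fun_of \<phi>) x\<bar> \<le> B" for \<phi> B
    unfolding heat_kernel_eq_gauss_mean
    unfolding mult_1_left
    by (rule gauss_mean_abs_le[OF fun_of_measurable]) (unfold test_deriv.rep_eq, rule B, rule order_refl)
  then show "continuous_on UNIV ?T"
    by (rule continuous_on_test_fun_order_bound[OF lin])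
qed

lemma heat_deriv_0: "heat_deriv 0 t = heat_kernel t"
proof -
  have "test_deriv 0 \<phi> = \<phi>" for \<phi> by (simp add: fun_of_inject[symmetric] test_deriv.rep_eq)
  then have "dist_apply (heat_deriv 0 t) = dist_apply (heat_kernel t)"
    by (simp add: fun_eq_iff heat_deriv.rep_eq)
  then show ?thesis by (simp add: dist_apply_inject)
qed

text \<open>The estimate of the quotient takes four derivatives of
  \<open>test_deriv (2 * k) \<phi>\<close>, hence the order \<open>2 * k + 4\<close>.\<close>

lemma order_bound_heat_deriv_quotient:
  assumes "0 \<le> s" "0 \<le> t" "s \<noteq> t"
  shows "order_bound (2 * k + 4) (3 / 2 * \<bar>s - t\<bar>)
    (inverse (s - t) *\<^sub>R (heat_deriv k s - heat_deriv k t) - heat_deriv (Suc k) t)"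
  unfolding order_bound_def
proof (intro allI impI)
  fix \<phi> B assume B: "\<forall>j\<le>2 * k + 4. \<forall>x. \<bar>(deriv ^^ j) (fun_of \<phi>) x\<bar> \<le> B"
  have "\<bar>fun_of (test_deriv 4 (test_deriv (2 * k) \<phi>)) x\<bar> \<le> B" for x
    unfolding test_deriv_add test_deriv.rep_eq by (rule B[rule_format]) simp
  from heat_kernel_quotient[OF assms this]
  show "\<bar>dist_apply (inverse (s - t) *\<^sub>R (heat_deriv k s - heat_deriv k t) - heat_deriv (Suc k) t) \<phi>\<bar>
      \<le> 3 / 2 * \<bar>s - t\<bar> * B"
    unfolding minus_distribution.rep_eq scaleR_distribution.rep_eq heat_deriv.rep_eq
      test_deriv_add mult_Suc_right divide_inverse
    by (simp only: mult.commute[of "inverse (s - t)"])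
qed

text \<open>By linearity the error of the real difference quotient is \<open>\<Phi>\<close> of the
  error in the distributions, hence at most a constant times
  \<open>\<bar>s - t\<bar>\<close>.\<close>

lemma smooth_dual_heat_deriv:
  assumes \<Phi>: "\<Phi> \<in> smooth_dual dist_plot" and t: "0 \<le> t"
  shows "((\<lambda>t. \<Phi> (heat_deriv k t)) has_real_derivative \<Phi> (heat_deriv (Suc k) t)) (at t within {0..})"
proof -
  have lin: "linear \<Phi>" using \<Phi> by (simp add: smooth_dual_def)
  obtain M where M: "\<And>T C. 0 < C \<Longrightarrow> order_bound (2 * k + 4) C T \<Longrightarrow> \<bar>\<Phi> T\<bar> \<le> M * C"
    using smooth_dual_bounded[OF \<Phi>] by metis
  let ?q = "\<lambda>s. (\<Phi> (heat_deriv k s) - \<Phi> (heat_deriv k t)) / (s - t)"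
  have "\<bar>?q s - \<Phi> (heat_deriv (Suc k) t)\<bar> \<le> M * (3 / 2 * \<bar>s - t\<bar>)" if s: "0 \<le> s" "s \<noteq> t" for s
  proof -
    have "?q s - \<Phi> (heat_deriv (Suc k) t) =
        \<Phi> (inverse (s - t) *\<^sub>R (heat_deriv k s - heat_deriv k t) - heat_deriv (Suc k) t)"
      by (simp add: linear_diff[OF lin] linear_scale[OF lin] divide_inverse mult.commute)
    then show ?thesis using M[OF _ order_bound_heat_deriv_quotient[OF s(1) t s(2), of k]] s by simp
  qed
  then have "\<forall>\<^sub>F s in at t within {0..}. norm (?q s - \<Phi> (heat_deriv (Suc k) t)) \<le> M * (3 / 2 * \<bar>s - t\<bar>)"
    by (auto simp: eventually_at_filter)
  moreover have "((\<lambda>s. M * (3 / 2 * \<bar>s - t\<bar>)) \<longlongrightarrow> M * (3 / 2 * \<bar>t - t\<bar>)) (at t within {0..})"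
    by (intro tendsto_intros)
  then have "((\<lambda>s. M * (3 / 2 * \<bar>s - t\<bar>)) \<longlongrightarrow> 0) (at t within {0..})" by simp
  ultimately have "((\<lambda>s. ?q s - \<Phi> (heat_deriv (Suc k) t)) \<longlongrightarrow> 0) (at t within {0..})"
    by (rule Lim_null_comparison)
  then show ?thesis unfolding has_field_derivative_iff by (simp add: LIM_zero_iff)
qed

theorem theorem4p1: "strongly_smooth (smooth_dual dist_plot) heat_kernel"
  unfolding strongly_smooth_def
proof (intro allI exI ballI)
  fix n \<Phi> assume \<Phi>: "\<Phi> \<in> smooth_dual dist_plot"
  \<comment> \<open>The witness \<open>heat_deriv n\<close> is the same for all
    \<open>\<Phi>\<close>, as strong smoothness demands.\<close>
  show "has_nth_derivative_on n (\<Phi> \<circ> heat_kernel) (\<Phi> \<circ> heat_deriv n) {0..}"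
    unfolding has_nth_derivative_on_def
    by (rule exI[of _ "\<lambda>k t. \<Phi> (heat_deriv k t)"]) (simp add: heat_deriv_0 smooth_dual_heat_deriv[OF \<Phi>])
qed

end
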